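(* Let $F(x_1,x_2,x_3)\in\mathbb{Z}[x_1,x_2,x_3]$ be a non-degenerate indefinite ternary integral quadratic form, let $\Delta$ denote its discriminant (the determinant of the Hessian matrix of $F$), and let $w:\mathbb{R}^3\to\mathbb{R}$ be a fixed infinitely differentiable, compactly supported weight function (of the class $\mathcal{C}(S)$ used in Heath-Brown's $\delta$-method). Fix $L\in\mathbb{N}$ with $8\Delta\mid L$, and $\boldsymbol{\Gamma}\in(\mathbb{Z}/L\mathbb{Z})^3$ with $F(\boldsymbol{\Gamma})\equiv0\bmod L$ and $\boldsymbol{\Gamma}\not\equiv\boldsymbol{0}\bmod p$ for every prime $p\mid L$. For $B\ge2$ let $$\mathcal{N}_{\mathcal{W}^o}(w,(L,\boldsymbol{\Gamma});B):=\sum_{\substack{\boldsymbol{x}\in\mathbb{Z}^3_{\mathrm{prim}},\ F(\boldsymbol{x})=0\\ \boldsymbol{x}\equiv\boldsymbol{\Gamma}\bmod L}}w\left(\frac{\boldsymbol{x}}{B}\right),$$ where $\mathbb{Z}^3_{\mathrm{prim}}$ is the set of $\boldsymbol{x}\in\mathbb{Z}^3$ with $\gcd(x_1,x_2,x_3)=1$. Then there exist a constant $\mathcal{G}_{L,\boldsymbol{\Gamma}}(w)\in\mathbb{C}$ depending on $w$ and $(L,\boldsymbol{\Gamma})$ and a numerical constant $c_0>0$ such that $$\mathcal{N}_{\mathcal{W}^o}(w,(L,\boldsymbol{\Gamma});B)=\left(\frac12\widehat{\mathfrak{S}}_{L,\boldsymbol{\Gamma}}\,\mathcal{I}(w)+\mathcal{G}_{L,\boldsymbol{\Gamma}}(w)\right)B+O\left(B\exp\left(-c_0(\log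 B)^{1/2}\right)\right).$$
   Context: Write $\mathrm{e}(x)=\exp(2\pi i x)$. The weighted singular integral is $$\mathcal{I}(w):=\int_{\mathbb{R}}\int_{\mathbb{R}^3}w(\boldsymbol{t})\,\mathrm{e}(\theta F(\boldsymbol{t}))\,d\boldsymbol{t}\,d\theta.$$ For each prime $p$, $$\sigma_p(L,\boldsymbol{\Gamma}):=\lim_{k\to\infty}\frac{\#\{\boldsymbol{x}\in(\mathbb{Z}/p^k\mathbb{Z})^3:\ F(\boldsymbol{x})\equiv 0\bmod p^k,\ \boldsymbol{x}\equiv\boldsymbol{\Gamma}\bmod p^{\operatorname{ord}_p(L)}\}}{p^{2k}},$$ and $\widehat{\mathfrak{S}}_{L,\boldsymbol{\Gamma}}:=\prod_{p}\left(1-\frac{1}{p}\right)\sigma_p(L,\boldsymbol{\Gamma})$. *)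

theory Defs
  imports "HOL-Analysis.Analysis" "HOL-Number_Theory.Number_Theory"
begin

text \<open>
  A ternary quadratic form over the integers is encoded by a coefficient matrix \<open>A\<close>, the polynomial
  being the sum over \<open>i, j\<close> of \<open>A\<^sub>i\<^sub>j X\<^sub>i X\<^sub>j\<close>. The matrix need not be symmetric: the coefficient of
  \<open>X\<^sub>i X\<^sub>j\<close> with \<open>i \<noteq> j\<close> is \<open>A\<^sub>i\<^sub>j + A\<^sub>j\<^sub>i\<close>, which may be odd, so every integral ternary quadratic
  form arises. All notions below depend only on the polynomial, not on the chosen \<open>A\<close>.
\<close>

definition qform :: "int^3^3 \<Rightarrow> 'a::comm_ring_1^3 \<Rightarrow> 'a" where
  "qform A x = (\<Sum>i\<in>UNIV. \<Sum>j\<in>UNIV. of_int (A $ i $ j) * x $ i * x $ j)"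

definition hessian :: "int^3^3 \<Rightarrow> int^3^3" where
  "hessian A = A + transpose A"

text \<open>The gradient of the form at \<open>x\<close> is \<open>hessian A\<close> applied to \<open>x\<close>, so \<open>hessian A\<close> is indeed the
  (constant) matrix of second partial derivatives.\<close>

lemma qform_has_derivative:
  fixes x :: "real^3"
  shows "(qform A has_derivative
           (\<lambda>h. ((\<chi> i j. real_of_int (hessian A $ i $ j)) *v x) \<bullet> h)) (at x)"
proof -
  have 1: "qform A = (\<lambda>x::real^3. \<Sum>i\<in>UNIV. \<Sum>j\<in>UNIV. of_int (A $ i $ j) * x $ i * x $ j)"
    by (rule ext) (simp add: qform_def)
  have 2: "((\<lambda>x::real^3. x $ i) has_derivative (\<lambda>h. h $ i)) (at x)" for i
    by (rule bounded_linear_imp_has_derivative) (rule bounded_linear_vec_nth)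
  have "(qform A has_derivative (\<lambda>h. \<Sum>i\<in>UNIV. \<Sum>j\<in>UNIV.
          of_int (A $ i $ j) * x $ i * h $ j + of_int (A $ i $ j) * h $ i * x $ j)) (at x)"
    unfolding 1
    by (intro has_derivative_sum has_derivative_mult has_derivative_mult_right 2)
  then show ?thesis
    by (rule has_derivative_eq_rhs)
      (simp add: hessian_def transpose_def matrix_vector_mult_def inner_vec_def sum_3 fun_eq_iff
         algebra_simps)
qed

definition disc :: "int^3^3 \<Rightarrow> int" where
  "disc A = det (hessian A)"

definition nondegenerate :: "int^3^3 \<Rightarrow> bool" where
  "nondegenerate A \<longleftrightarrow> disc A \<noteq> 0"

definition indefinite :: "int^3^3 \<Rightarrow> bool" where
  "indefinite A \<longleftrightarrow> (\<exists>(x :: real^3) (y :: real^3). qform A x > 0 \<and> qform A y < 0)"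

text \<open>\<open>Ck n f\<close>: all iterated directional derivatives of \<open>f\<close> up to order \<open>n\<close> exist and are continuous.\<close>

primrec Ck :: "nat \<Rightarrow> ('a::real_normed_vector \<Rightarrow> 'b::real_normed_vector) \<Rightarrow> bool" where
  "Ck 0 f \<longleftrightarrow> continuous_on UNIV f"
| "Ck (Suc n) f \<longleftrightarrow> (\<forall>x. f differentiable (at x)) \<and>
     (\<forall>v. Ck n (\<lambda>x. frechet_derivative f (at x) v))"

text \<open>Heath-Brown's class \<open>C(S)\<close> collects the smooth compactly supported functions whose support radius and
  partial derivatives are bounded in terms of the parameters \<open>S\<close>. It serves to make estimates uniform
  in the weight; for a single fixed weight it reduces to smoothness and compact support.\<close>

definition weight_function :: "(real^3 \<Rightarrow> real) \<Rightarrow> bool" where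
  "weight_function w \<longleftrightarrow> (\<forall>n. Ck n w) \<and> compact (closure {t. w t \<noteq> 0})"

definition ee :: "real \<Rightarrow> complex" where
  "ee x = exp (2 * of_real pi * \<i> * of_real x)"

definition singular_integral :: "int^3^3 \<Rightarrow> (real^3 \<Rightarrow> real) \<Rightarrow> complex" where
  "singular_integral A w =
     (\<integral>\<theta>. (\<integral>t. of_real (w t) * ee (\<theta> * qform A t) \<partial>lborel) \<partial>lborel)"

definition vec_cong :: "int^3 \<Rightarrow> int^3 \<Rightarrow> int \<Rightarrow> bool" where
  "vec_cong x y m \<longleftrightarrow> (\<forall>i. [x $ i = y $ i] (mod m))"

text \<open>Elements of \<open>(\<int>/p\<^sup>k\<int>)\<^sup>3\<close> are represented by integer vectors with entries in \<open>{0..<p ^ k}\<close>. The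
  congruence modulo \<open>p ^ multiplicity p L\<close> depends only on the residue class once
  \<open>k \<ge> multiplicity p L\<close>, which is all that matters for the limit.\<close>

definition local_count :: "int^3^3 \<Rightarrow> nat \<Rightarrow> int^3 \<Rightarrow> nat \<Rightarrow> nat \<Rightarrow> nat" where
  "local_count A L \<Gamma> p k = card {x :: int^3.
     (\<forall>i. x $ i \<in> {0..<int p ^ k}) \<and>
     [qform A x = 0] (mod int p ^ k) \<and>
     vec_cong x \<Gamma> (int p ^ multiplicity p L)}"

definition local_density :: "int^3^3 \<Rightarrow> nat \<Rightarrow> int^3 \<Rightarrow> nat \<Rightarrow> real" where
  "local_density A L \<Gamma> p = lim (\<lambda>k. real (local_count A L \<Gamma> p k) / real p ^ (2 * k))"

definition singular_series :: "int^3^3 \<Rightarrow> nat \<Rightarrow> int^3 \<Rightarrow> real" where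
  "singular_series A L \<Gamma> =
     prodinf (\<lambda>p. if prime p then (1 - 1 / real p) * local_density A L \<Gamma> p else 1)"

definition primitive :: "int^3 \<Rightarrow> bool" where
  "primitive x \<longleftrightarrow> gcd (x $ 1) (gcd (x $ 2) (x $ 3)) = 1"

text \<open>For a weight function only finitely many terms of the sum are non-zero.\<close>

definition weighted_count ::
    "int^3^3 \<Rightarrow> (real^3 \<Rightarrow> real) \<Rightarrow> nat \<Rightarrow> int^3 \<Rightarrow> real \<Rightarrow> real" where
  "weighted_count A w L \<Gamma> B =
     (\<Sum>\<^sub>\<infinity>x | primitive x \<and> qform A x = 0 \<and> vec_cong x \<Gamma> (int L).
        w (\<chi> i. real_of_int (x $ i) / B))"

end

theory Submission
  imports Defs "HOL-Computational_Algebra.Squarefree"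
begin

text \<open>
  Since the constant \<open>G\<close> is arbitrary, it suffices to show that the weighted count is
  \<open>K B + O(B powr (3/4))\<close> for some \<open>K\<close>; singular series and singular integral are absorbed in \<open>G\<close>.
  If the form is anisotropic the count is zero. Otherwise an integral change of variables \<open>P\<close> turns it
  into a multiple of \<open>y\<^sub>1 y\<^sub>3 - y\<^sub>2\<^sup>2\<close>, so the primitive zeros are the vectors \<open>x\<close> with
  \<open>P (u\<^sup>2, u v, v\<^sup>2) = g x\<close> for coprime \<open>u, v\<close>, where \<open>g\<close> divides a fixed integer \<open>D\<close>, and each zero
  arises from two pairs \<open>\<plusminus>(u, v)\<close>. For fixed \<open>g\<close> the conditions on \<open>x\<close> depend only on \<open>(u, v)\<close> modulo
  \<open>D L\<close>, so everything reduces to sums of a Lipschitz function of compact support over the primitive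
  points \<open>(u, v) / sqrt B\<close> of a residue class. Moebius inversion expresses these through
  full lattice sums, which are Riemann sums. The bound \<open>O(Y powr (3/2))\<close> used for the error of a lattice
  sum with origin removed, \<open>Y = X / d\<close>, holds for large and small \<open>Y\<close> alike and is summable over \<open>d\<close>.
\<close>

section \<open>The Moebius function\<close>

definition moebius_mu :: "nat \<Rightarrow> real" where
  "moebius_mu n = (if squarefree n then (-1) ^ card (prime_factors n) else 0)"

lemma abs_moebius_mu_le: "\<bar>moebius_mu n\<bar> \<le> 1"
  by (simp add: moebius_mu_def power_abs)

lemma moebius_mu_prime_mult:
  assumes "prime p" "\<not> p dvd d" "squarefree d"
  shows "moebius_mu (p * d) = - moebius_mu d"
proof -
  have d: "d \<noteq> 0" using assms(3) not_squarefree_0 by metis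
  have cop: "coprime p d" using assms by (simp add: prime_imp_coprime)
  have "squarefree (p * d)"
    using cop assms(3) squarefree_prime[OF assms(1)] by (intro squarefree_mult_coprime) auto
  moreover have "prime_factors (p * d) = insert p (prime_factors d)"
    using d assms(1) by (simp add: prime_factors_product prime_prime_factors not_prime_0)
  moreover have "p \<notin> prime_factors d" using assms(2) by auto
  ultimately show ?thesis using assms(3) by (simp add: moebius_mu_def)
qed

text \<open>For \<open>n > 1\<close> fix a prime \<open>p\<close> dividing \<open>n\<close>.
  Multiplication by \<open>p\<close> matches the squarefree divisors prime to \<open>p\<close> with
  those divisible by \<open>p\<close> and flips the sign of \<open>moebius_mu\<close>, so the sum
  cancels.\<close>

lemma sum_moebius_mu_divisors:
  assumes "n > 0"
  shows "(\<Sum>d | d dvd n. moebius_mu d) = (if n = 1 then 1 else 0)"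
proof (cases "n = 1")
  case True
  then have "{d. d dvd n} = {1}" by auto
  then show ?thesis using True by (simp add: moebius_mu_def)
next
  case False
  then obtain p where p: "prime p" "p dvd n" using prime_factor_nat by blast
  have fin: "finite {d. d dvd n}" using assms by simp
  define A where "A = {d. d dvd n \<and> squarefree d \<and> \<not> p dvd d}"
  define B where "B = {d. d dvd n \<and> squarefree d \<and> p dvd d}"
  have AB: "A \<subseteq> {d. d dvd n}" "B \<subseteq> {d. d dvd n}" by (auto simp: A_def B_def)
  have finAB: "finite A" "finite B" using finite_subset[OF _ fin] AB by blast+
  have B: "B = (*) p ` A"
  proof (intro equalityI subsetI)
    fix d assume d: "d \<in> B"
    then obtain e where e: "d = p * e" by (auto simp: B_def)
    have "\<not> p dvd e"
    proof
      assume "p dvd e"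
      then have "p ^ 2 dvd d" using e by (simp add: power2_eq_square)
      then show False using d p(1) squarefreeD[of d p] by (auto simp: B_def)
    qed
    moreover have "squarefree e" using d e squarefree_mono[of e d] by (auto simp: B_def)
    moreover have "e dvd n" using d e by (auto simp: B_def intro: dvd_trans dvd_mult_right)
    ultimately show "d \<in> (*) p ` A" using e by (auto simp: A_def)
  next
    fix d assume "d \<in> (*) p ` A"
    then obtain e where e: "e dvd n" "squarefree e" "\<not> p dvd e" "d = p * e" by (auto simp: A_def)
    have "coprime p e" using p e by (simp add: prime_imp_coprime)
    then have "p * e dvd n" "squarefree (p * e)" using e p squarefree_prime[OF p(1)]
      by (auto simp: divides_mult intro: squarefree_mult_coprime)
    then show "d \<in> B" using e by (simp add: B_def)
  qed
  have "(\<Sum>d | d dvd n. moebius_mu d) = (\<Sum>d\<in>A \<union> B. moebius_mu d)"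
    by (rule sum.mono_neutral_right[OF fin]) (auto simp: A_def B_def moebius_mu_def)
  also have "\<dots> = (\<Sum>d\<in>A. moebius_mu d) + (\<Sum>d\<in>B. moebius_mu d)"
    using finAB by (rule sum.union_disjoint) (auto simp: A_def B_def)
  also have "(\<Sum>d\<in>B. moebius_mu d) = (\<Sum>d\<in>A. moebius_mu (p * d))"
    unfolding B using p(1) by (subst sum.reindex) (auto simp: inj_on_def prime_gt_0_nat)
  also have "\<dots> = (\<Sum>d\<in>A. - moebius_mu d)"
    using p(1) by (intro sum.cong moebius_mu_prime_mult) (auto simp: A_def)
  finally show ?thesis using False by (simp add: sum_negf)
qed

section \<open>Lipschitz weights of compact support in the plane\<close>

definition lattice_box :: "real \<Rightarrow> (int \<times> int) set" where
  "lattice_box N = {(u, v). \<bar>real_of_int u\<bar> \<le> N \<and> \<bar>real_of_int v\<bar> \<le> N}"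

lemma finite_lattice_box [simp, intro]: "finite (lattice_box N)"
proof -
  have "lattice_box N \<subseteq> {-\<lceil>N\<rceil>..\<lceil>N\<rceil>} \<times> {-\<lceil>N\<rceil>..\<lceil>N\<rceil>}"
    by (auto simp: lattice_box_def) linarith+
  then show ?thesis by (rule finite_subset) auto
qed

text \<open>The Lipschitz bound drives the comparison of lattice sums with integrals. The
  normalization \<open>R \<ge> 1\<close> makes \<open>R * Y < 1\<close> imply
  \<open>Y \<le> 1\<close> and lets \<open>R powr (1/2)\<close> be rounded up to
  \<open>R\<close>.\<close>

locale planar_weight =
  fixes f :: "real \<times> real \<Rightarrow> real" and R \<Lambda> :: real
  assumes R_ge_1: "R \<ge> 1"
    and supported: "f (a, b) \<noteq> 0 \<Longrightarrow> \<bar>a\<bar> \<le> R \<and> \<bar>b\<bar> \<le> R"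
    and lipschitz: "\<bar>f (a, b) - f (a', b')\<bar> \<le> \<Lambda> * (\<bar>a - a'\<bar> + \<bar>b - b'\<bar>)"
begin

lemma lipschitz_const_nonneg: "\<Lambda> \<ge> 0"
  using lipschitz[of 0 0 1 0] by simp

lemma continuous_weight: "continuous_on UNIV f"
proof -
  have "(2 * \<Lambda>)-lipschitz_on UNIV f"
  proof (rule lipschitz_onI)
    fix x y :: "real \<times> real"
    obtain a b a' b' where xy: "x = (a, b)" "y = (a', b')" by fastforce
    have "\<bar>a - a'\<bar> \<le> dist x y" "\<bar>b - b'\<bar> \<le> dist x y"
      unfolding xy dist_Pair_Pair by (auto simp: dist_real_def intro: order_trans[OF _ real_sqrt_sum_squares_ge1] order_trans[OF _ real_sqrt_sum_squares_ge2])
    then have "\<Lambda> * (\<bar>a - a'\<bar> + \<bar>b - b'\<bar>) \<le> \<Lambda> * (2 * dist x y)"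
      using lipschitz_const_nonneg by (intro mult_left_mono) auto
    then show "dist (f x) (f y) \<le> 2 * \<Lambda> * dist x y"
      using lipschitz[of a b a' b'] by (simp add: xy dist_real_def)
  qed (use lipschitz_const_nonneg in auto)
  then show ?thesis by (rule lipschitz_on_continuous_on)
qed

lemma integrable_weight: "integrable lborel f"
proof -
  have "integrable lborel (\<lambda>x. indicator (cbox (-R, -R) (R, R)) x *\<^sub>R f x)"
    by (rule borel_integrable_compact) (auto intro: continuous_on_subset[OF continuous_weight])
  also have "(\<lambda>x. indicator (cbox (-R, -R) (R, R)) x *\<^sub>R f x) = f"
  proof
    fix x show "indicator (cbox (-R, -R) (R, R)) x *\<^sub>R f x = f x"
      using supported[of "fst x" "snd x"]
      by (cases x) (auto simp: indicator_def cbox_Pair_eq)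
  qed
  finally show ?thesis .
qed

end

text \<open>The rectangles are half-open so that the cells attached to the points of a residue class
  tile the plane.\<close>

lemma measure_lborel_rectangle:
  fixes a b c d :: real
  assumes "a \<le> b" "c \<le> d"
  shows "{a..<b} \<times> {c..<d} \<in> sets lborel"
    and "emeasure lborel ({a..<b} \<times> {c..<d}) < \<infinity>"
    and "measure lborel ({a..<b} \<times> {c..<d}) = (b - a) * (d - c)"
proof -
  show "{a..<b} \<times> {c..<d} \<in> sets lborel"
    by (simp add: borel_Times)
  have "emeasure lborel ({a..<b} \<times> {c..<d}) = ennreal ((b - a) * (d - c))"
    unfolding lborel_prod[symmetric] using assms
    by (subst lborel.emeasure_pair_measure_Times) (auto simp: ennreal_mult)
  then show "emeasure lborel ({a..<b} \<times> {c..<d}) < \<infinity>"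
    and "measure lborel ({a..<b} \<times> {c..<d}) = (b - a) * (d - c)"
    using assms by (simp_all add: measure_def)
qed

section \<open>Lattice points in a residue class\<close>

text \<open>For \<open>m > 0\<close> this is the largest integer not exceeding \<open>t\<close> in
  the class of \<open>s\<close> modulo \<open>m\<close>.\<close>

definition round_to_class :: "int \<Rightarrow> int \<Rightarrow> real \<Rightarrow> int" where
  "round_to_class m s t = s + m * \<lfloor>(t - real_of_int s) / real_of_int m\<rfloor>"

lemma round_to_class_eq_iff:
  assumes "m > 0" "[u = s] (mod m)"
  shows "real_of_int u \<le> t \<and> t < real_of_int (u + m) \<longleftrightarrow> u = round_to_class m s t"
proof -
  obtain k where k: "u = s + m * k"
    using assms(2) by (metis cong_iff_lin cong_sym)
  have m: "real_of_int m > 0" using assms by simp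
  have "real_of_int u \<le> t \<and> t < real_of_int (u + m) \<longleftrightarrow>
      real_of_int k \<le> (t - real_of_int s) / real_of_int m \<and> (t - real_of_int s) / real_of_int m < real_of_int k + 1"
    using m by (simp add: k pos_le_divide_eq pos_divide_less_eq algebra_simps)
  also have "\<dots> \<longleftrightarrow> k = \<lfloor>(t - real_of_int s) / real_of_int m\<rfloor>" by linarith
  also have "\<dots> \<longleftrightarrow> u = round_to_class m s t" using assms(1) by (simp add: round_to_class_def k)
  finally show ?thesis .
qed

lemma cong_round_to_class: "[round_to_class m s t = s] (mod m)"
  by (simp add: round_to_class_def cong_def)

definition class_box :: "int \<Rightarrow> int \<times> int \<Rightarrow> real \<Rightarrow> (int \<times> int) set" where
  "class_box m s N = {z \<in> lattice_box N. [fst z = fst s] (mod m) \<and> [snd z = snd s] (mod m)}"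

lemma finite_class_box [simp, intro]: "finite (class_box m s N)"
  by (simp add: class_box_def)

context planar_weight
begin

definition scaled_sum :: "(int \<times> int) set \<Rightarrow> real \<Rightarrow> real" where
  "scaled_sum Z X = (\<Sum>z\<in>Z. f (real_of_int (fst z) / X, real_of_int (snd z) / X))"

text \<open>After scaling by \<open>X\<close>, each point of the class is the lower left corner of a
  square cell of side \<open>\<delta>\<close>. Freezing \<open>f\<close> at the corners gives a step
  function \<open>g\<close> whose integral is \<open>\<delta>\<^sup>2\<close> times the lattice sum.
  It differs from \<open>f\<close> by at most \<open>2 * \<Lambda> * \<delta>\<close>, and only on a
  bounded square.\<close>

lemma lattice_sum_error:
  assumes X: "X > 0" and m: "m > (0::int)"
  defines "\<delta> \<equiv> real_of_int m / X"
  shows "\<bar>integral\<^sup>L lborel f - \<delta>\<^sup>2 * scaled_sum (class_box m s (R * X)) X\<bar>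
           \<le> 2 * \<Lambda> * \<delta> * (2 * (R + 2 * \<delta>))\<^sup>2"
proof -
  obtain s1 s2 where s: "s = (s1, s2)" by fastforce
  define Z where "Z = class_box m s (R * X)"
  define Q where "Q u v = {real_of_int u / X..<real_of_int (u + m) / X} \<times> {real_of_int v / X..<real_of_int (v + m) / X}" for u v
  define g where "g t = (\<Sum>(u, v)\<in>Z. f (u / X, v / X) * indicator (Q u v) t)" for t
  \<comment> \<open>A coordinate of the corner of the cell that contains the given point.\<close>
  define c where "c s t = real_of_int (round_to_class m s (t * X)) / X" for s t
  have \<delta>: "\<delta> > 0" using X m by (simp add: \<delta>_def)
  have c_close: "\<bar>a - c s a\<bar> \<le> \<delta>" for a s
  proof -
    have "real_of_int (round_to_class m s (a * X)) \<le> a * X \<and> a * X < real_of_int (round_to_class m s (a * X) + m)"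
      using round_to_class_eq_iff[OF m cong_round_to_class[of m s "a * X"], of "a * X"] by blast
    then have "c s a \<le> a" "a < c s a + \<delta>"
      using X by (simp_all add: c_def \<delta>_def field_simps)
    then show ?thesis by linarith
  qed
  have g_eq: "g (a, b) = f (c s1 a, c s2 b)" for a b
  proof -
    define z where "z = (round_to_class m s1 (a * X), round_to_class m s2 (b * X))"
    have mem: "(a, b) \<in> Q u v \<longleftrightarrow> (u, v) = z" if "(u, v) \<in> Z" for u v
    proof -
      have uv: "[u = s1] (mod m)" "[v = s2] (mod m)"
        using that by (auto simp: Z_def class_box_def s)
      show ?thesis
        using round_to_class_eq_iff[OF m uv(1), of "a * X"] round_to_class_eq_iff[OF m uv(2), of "b * X"] X
        by (auto simp: Q_def z_def field_simps)
    qed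
    have "g (a, b) = (\<Sum>y\<in>Z. if y = z then f (fst z / X, snd z / X) else 0)"
      unfolding g_def by (intro sum.cong) (auto simp: mem indicator_def split: if_splits)
    also have "\<dots> = (if z \<in> Z then f (fst z / X, snd z / X) else 0)"
      by (simp add: Z_def)
    also have "\<dots> = f (fst z / X, snd z / X)"
    proof (cases "z \<in> Z")
      \<comment> \<open>A corner outside the box lies outside the support, so the cut-off in
        \<open>class_box\<close> drops only zero terms.\<close>
      case False
      then have "z \<notin> lattice_box (R * X)"
        by (auto simp: Z_def class_box_def z_def s cong_round_to_class)
      then have "\<not> (\<bar>fst z / X\<bar> \<le> R \<and> \<bar>snd z / X\<bar> \<le> R)"
        using X by (auto simp: lattice_box_def z_def field_simps)
      then have "f (fst z / X, snd z / X) = 0"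
        using supported[of "fst z / X" "snd z / X"] by blast
      then show ?thesis using False by simp
    qed auto
    finally show ?thesis by (simp add: z_def c_def)
  qed
  \<comment> \<open>The margin \<open>2 * \<delta>\<close> ensures that off \<open>S\<close> a point
    and its corner, at most \<open>\<delta>\<close> apart in each coordinate, both lie outside the
    support.\<close>
  define S where "S = {-(R + 2 * \<delta>)..<R + 2 * \<delta>} \<times> {-(R + 2 * \<delta>)..<R + 2 * \<delta>}"
  have S: "S \<in> sets lborel" "emeasure lborel S < \<infinity>" "measure lborel S = (2 * (R + 2 * \<delta>))\<^sup>2"
    using measure_lborel_rectangle[of "-(R + 2 * \<delta>)" "R + 2 * \<delta>" "-(R + 2 * \<delta>)" "R + 2 * \<delta>"] R_ge_1 \<delta>
    by (auto simp: S_def power2_eq_square algebra_simps)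
  have Q: "Q u v \<in> sets lborel" "emeasure lborel (Q u v) < \<infinity>" "measure lborel (Q u v) = \<delta>\<^sup>2" for u v
    using measure_lborel_rectangle[of "real_of_int u / X" "real_of_int (u + m) / X" "real_of_int v / X" "real_of_int (v + m) / X"] X m
    by (auto simp: Q_def power2_eq_square \<delta>_def divide_simps)
  have bound: "\<bar>f t - g t\<bar> \<le> 2 * \<Lambda> * \<delta> * indicator S t" for t
  proof (cases t)
    case (Pair a b)
    show ?thesis
    proof (cases "t \<in> S")
      case True
      have "\<bar>f (a, b) - f (c s1 a, c s2 b)\<bar> \<le> \<Lambda> * (\<bar>a - c s1 a\<bar> + \<bar>b - c s2 b\<bar>)"
        by (rule lipschitz)
      also have "\<dots> \<le> \<Lambda> * (\<delta> + \<delta>)"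
        by (intro mult_left_mono add_mono c_close lipschitz_const_nonneg)
      finally show ?thesis using True by (simp add: g_eq Pair)
    next
      case False
      then have "\<bar>a\<bar> \<ge> R + 2 * \<delta> \<or> \<bar>b\<bar> \<ge> R + 2 * \<delta>" by (auto simp: Pair S_def)
      moreover have "\<not> \<bar>a - c s1 a\<bar> > \<delta>" "\<not> \<bar>b - c s2 b\<bar> > \<delta>"
        using c_close[of a s1] c_close[of b s2] by auto
      ultimately have "f (a, b) = 0 \<and> f (c s1 a, c s2 b) = 0"
        using \<delta> supported[of a b] supported[of "c s1 a" "c s2 b"] by (smt (verit))
      then show ?thesis using False by (simp add: Pair g_eq)
    qed
  qed
  have int_g: "integrable lborel g"
    unfolding g_def using Q by (auto intro!: Bochner_Integration.integrable_sum integrable_mult_right integrable_real_indicator simp: case_prod_beta)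
  have "integral\<^sup>L lborel g = (\<Sum>(u, v)\<in>Z. f (u / X, v / X) * \<delta>\<^sup>2)"
    unfolding g_def case_prod_beta using Q
    by (subst Bochner_Integration.integral_sum) (auto intro!: integrable_mult_right integrable_real_indicator)
  also have "\<dots> = \<delta>\<^sup>2 * (\<Sum>(u, v)\<in>Z. f (u / X, v / X))"
    by (simp add: sum_distrib_left case_prod_beta mult.commute)
  finally have "\<bar>integral\<^sup>L lborel f - \<delta>\<^sup>2 * (\<Sum>(u, v)\<in>Z. f (u / X, v / X))\<bar> = \<bar>integral\<^sup>L lborel (\<lambda>t. f t - g t)\<bar>"
    using integrable_weight int_g by simp
  also have "\<dots> \<le> integral\<^sup>L lborel (\<lambda>t. 2 * \<Lambda> * \<delta> * indicator S t)"
    using S bound by (intro integral_abs_bound_integral) (auto intro!: Bochner_Integration.integrable_diff integrable_weight int_g integrable_mult_right integrable_real_indicator)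
  also have "\<dots> = 2 * \<Lambda> * \<delta> * (2 * (R + 2 * \<delta>))\<^sup>2" using S by simp
  finally show ?thesis by (simp add: Z_def scaled_sum_def case_prod_beta)
qed

end

section \<open>Primitive lattice points in a residue class\<close>

context planar_weight
begin

text \<open>The constant is uniform in \<open>d\<close>. With \<open>Y = X / d\<close> the Riemann
  sum error is \<open>O(Y)\<close> and the removed origin costs \<open>O(1)\<close>; for
  \<open>R * Y < 1\<close> the sum is empty and the main term is \<open>O(Y\<^sup>2)\<close>. The
  exponent 3/2 exceeds 1, so that the errors can be summed over \<open>d\<close>, and is below 2, so
  that it covers small \<open>Y\<close>.\<close>

lemma sublattice_sum:
  fixes M :: int
  assumes M: "M > 0"
  obtains C where "\<And>X d m s. X > 0 \<Longrightarrow> d > 0 \<Longrightarrow> d \<le> m \<Longrightarrow> m \<le> d * M \<Longrightarrow> d dvd m \<Longrightarrow>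
      d dvd fst s \<Longrightarrow> d dvd snd s \<Longrightarrow>
      \<bar>scaled_sum (class_box m s (R * X) - {(0, 0)}) X
        - integral\<^sup>L lborel f / (real_of_int m)\<^sup>2 * X\<^sup>2\<bar> \<le> C * (X / real_of_int d) powr (3/2)"
    and "C \<ge> 0"
proof -
  define J where "J = integral\<^sup>L lborel f"
  \<comment> \<open>\<open>C1\<close> is the Riemann sum error under
    \<open>\<delta> \<le> M * R\<close>, which holds once \<open>R * Y \<ge> 1\<close>. The summands
    of \<open>C\<close> pay for the main term when the sum is empty, for the origin, and for the
    Riemann sum error.\<close>
  define C1 where "C1 = 2 * \<Lambda> * (2 * (R + 2 * (M * R)))\<^sup>2"
  define C where "C = \<bar>J\<bar> + \<bar>f (0, 0)\<bar> * R\<^sup>2 + C1 * R"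
  have C1: "C1 \<ge> 0" using lipschitz_const_nonneg by (simp add: C1_def)
  have R: "R \<ge> 1" by (rule R_ge_1)
  show ?thesis
  proof
    show "C \<ge> 0" using C1 R by (simp add: C_def)
  next
    fix X :: real and d m :: int and s :: "int \<times> int"
    assume X: "X > 0" and d: "d > 0" and dm: "d \<le> m" "m \<le> d * M" "d dvd m"
      and s: "d dvd fst s" "d dvd snd s"
    define Z where "Z = class_box m s (R * X)"
    define Y where "Y = X / real_of_int d"
    define S where "S = scaled_sum (Z - {(0, 0)}) X"
    have Y: "Y > 0" using X d by (simp add: Y_def)
    have m: "m > 0" using d dm by simp
    have Xm: "X / real_of_int m \<le> Y"
      using X d dm unfolding Y_def by (intro divide_left_mono) auto
    have dvd: "d dvd u \<and> d dvd v" if "(u, v) \<in> Z" for u v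
    proof -
      have "[u = fst s] (mod d)" "[v = snd s] (mod d)"
        using that dm(3) by (auto simp: Z_def class_box_def intro: cong_dvd_modulus)
      then show ?thesis using s cong_dvd_iff by blast
    qed
    have "\<bar>S - J / (real_of_int m)\<^sup>2 * X\<^sup>2\<bar> \<le> C * Y powr (3/2)"
    proof (cases "R * Y < 1")
      case True
      \<comment> \<open>The coordinates are multiples of \<open>d\<close> but smaller than
        \<open>d\<close> in absolute value.\<close>
      have "Z - {(0, 0)} = {}"
      proof (rule ccontr)
        assume "Z - {(0, 0)} \<noteq> {}"
        then obtain u v where uv: "(u, v) \<in> Z" "(u, v) \<noteq> (0, 0)" by auto
        have "R * X < d" using True d by (simp add: Y_def field_simps)
        then have "\<bar>u\<bar> < d \<and> \<bar>v\<bar> < d"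
          using uv(1) by (auto simp: Z_def class_box_def lattice_box_def)
        then show False using dvd[OF uv(1)] uv(2) d dvd_imp_le_int[of u d] dvd_imp_le_int[of v d] by auto
      qed
      then have S0: "S = 0" unfolding S_def scaled_sum_def by (simp only: sum.empty)
      have "Y \<le> 1" using True R Y by (smt (verit) mult_le_cancel_right1)
      have "J / (real_of_int m)\<^sup>2 * X\<^sup>2 = J * (X / real_of_int m)\<^sup>2"
        by (simp add: power_divide)
      then have "\<bar>S - J / (real_of_int m)\<^sup>2 * X\<^sup>2\<bar> = \<bar>J\<bar> * (X / real_of_int m)\<^sup>2"
        by (simp add: S0 abs_mult)
      also have "\<dots> \<le> \<bar>J\<bar> * Y\<^sup>2"
        using Xm X m by (intro mult_left_mono power_mono) auto
      also have "Y\<^sup>2 = Y powr 2" using Y by simp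
      also have "\<bar>J\<bar> * Y powr 2 \<le> \<bar>J\<bar> * Y powr (3/2)"
        using \<open>Y \<le> 1\<close> Y by (intro mult_left_mono powr_mono') auto
      also have "\<dots> \<le> C * Y powr (3/2)"
        using C1 R by (intro mult_right_mono) (auto simp: C_def)
      finally show ?thesis .
    next
      case False
      define \<delta> where "\<delta> = real_of_int m / X"
      have \<delta>: "\<delta> > 0" using X m by (simp add: \<delta>_def)
      have inv\<delta>: "1 / \<delta> \<le> Y" using Xm by (simp add: \<delta>_def)
      have "real_of_int m \<le> real_of_int d * real_of_int M" using dm(2) by (metis of_int_le_iff of_int_mult)
      then have "\<delta> \<le> M / Y" using X d by (simp add: \<delta>_def Y_def field_simps)
      also have "\<dots> \<le> M * R" using False Y M by (simp add: field_simps)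
      finally have \<delta>_le: "\<delta> \<le> M * R" .
      define T where "T = scaled_sum Z X"
      have "\<bar>J - \<delta>\<^sup>2 * T\<bar> \<le> 2 * \<Lambda> * \<delta> * (2 * (R + 2 * \<delta>))\<^sup>2"
        using lattice_sum_error[OF X m, of s] by (simp add: J_def T_def Z_def \<delta>_def)
      also have "\<dots> \<le> 2 * \<Lambda> * \<delta> * (2 * (R + 2 * (M * R)))\<^sup>2"
        using \<delta> \<delta>_le R lipschitz_const_nonneg by (intro mult_left_mono power_mono) auto
      also have "\<dots> = \<delta> * C1" by (simp add: C1_def)
      finally have "\<bar>J - \<delta>\<^sup>2 * T\<bar> / \<delta>\<^sup>2 \<le> \<delta> * C1 / \<delta>\<^sup>2"
        using \<delta> by (intro divide_right_mono) auto
      also have "\<delta> * C1 / \<delta>\<^sup>2 = C1 * (1 / \<delta>)" using \<delta> by (simp add: power2_eq_square)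
      also have "\<dots> \<le> C1 * Y" by (rule mult_left_mono[OF inv\<delta> C1])
      also have "\<bar>J - \<delta>\<^sup>2 * T\<bar> / \<delta>\<^sup>2 = \<bar>(J - \<delta>\<^sup>2 * T) / \<delta>\<^sup>2\<bar>" by simp
      also have "(J - \<delta>\<^sup>2 * T) / \<delta>\<^sup>2 = J / (real_of_int m)\<^sup>2 * X\<^sup>2 - T"
        using X m by (simp add: \<delta>_def field_simps)
      finally have 1: "\<bar>T - J / (real_of_int m)\<^sup>2 * X\<^sup>2\<bar> \<le> C1 * Y" by (simp add: abs_minus_commute)
      have "\<bar>T - S\<bar> \<le> \<bar>f (0, 0)\<bar>"
      proof (cases "(0, 0) \<in> Z")
        case True
        then have "T = f (0, 0) + S"
          unfolding T_def S_def scaled_sum_def by (subst sum.remove[of _ "(0,0)"]) (auto simp: Z_def)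
        then show ?thesis by simp
      qed (simp add: T_def S_def)
      with 1 have 2: "\<bar>S - J / (real_of_int m)\<^sup>2 * X\<^sup>2\<bar> \<le> \<bar>f (0, 0)\<bar> + C1 * Y" by linarith
      have RY: "R * Y \<ge> 1" using False by simp
      \<comment> \<open>Since \<open>R * Y \<ge> 1\<close>, the errors \<open>1\<close> and
        \<open>Y\<close> are both multiples of \<open>Y powr (3/2)\<close> at the cost of powers of
        \<open>R\<close>.\<close>
      have half: "1 \<le> R * Y powr (1/2)"
      proof -
        have "1 \<le> (R * Y) powr (1/2)" using RY by (simp add: ge_one_powr_ge_zero)
        also have "\<dots> = R powr (1/2) * Y powr (1/2)" using R Y by (simp add: powr_mult)
        also have "\<dots> \<le> R powr 1 * Y powr (1/2)" using R by (intro mult_right_mono powr_mono) auto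
        finally show ?thesis using R by simp
      qed
      have split: "Y powr (3/2) = Y * Y powr (1/2)"
        using Y powr_add[of Y 1 "1/2"] by simp
      have Y1: "Y \<le> R * Y powr (3/2)"
        using mult_left_mono[OF half, of Y] Y by (simp add: split algebra_simps)
      have "1 \<le> R * Y" by (rule RY)
      also have "\<dots> \<le> R * (R * Y powr (3/2))" using Y1 R by (intro mult_left_mono) auto
      finally have Y2: "1 \<le> R\<^sup>2 * Y powr (3/2)" by (simp add: power2_eq_square mult.assoc)
      have "\<bar>f (0, 0)\<bar> + C1 * Y \<le> \<bar>f (0, 0)\<bar> * (R\<^sup>2 * Y powr (3/2)) + C1 * (R * Y powr (3/2))"
        using mult_left_mono[OF Y2, of "\<bar>f (0, 0)\<bar>"] mult_left_mono[OF Y1 C1] by simp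
      also have "\<dots> \<le> C * Y powr (3/2)" by (simp add: C_def algebra_simps)
      finally show ?thesis using 2 by linarith
    qed
    then show "\<bar>scaled_sum (class_box m s (R * X) - {(0, 0)}) X
        - integral\<^sup>L lborel f / (real_of_int m)\<^sup>2 * X\<^sup>2\<bar> \<le> C * (X / real_of_int d) powr (3/2)"
      by (simp add: S_def Z_def J_def Y_def)
  qed
qed

text \<open>By the Chinese remainder theorem the conditions modulo \<open>M\<close> and modulo
  \<open>d\<close> are either incompatible or define one class modulo their lcm, which lies between
  \<open>d\<close> and \<open>d * M\<close>. The bound on \<open>\<kappa>\<close> makes the later
  series over \<open>d\<close> converge.\<close>

lemma divisible_class_sum:
  fixes M :: int and r :: "int \<times> int"
  assumes M: "M > 0"
  obtains C \<kappa> where "\<And>X d. X > 0 \<Longrightarrow> d > 0 \<Longrightarrow>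
      \<bar>scaled_sum {z \<in> class_box M r (R * X) - {(0, 0)}. int d dvd fst z \<and> int d dvd snd z} X
        - \<kappa> d * X\<^sup>2\<bar> \<le> C * (X / real d) powr (3/2)"
    and "C \<ge> 0" and "\<And>d. d > 0 \<Longrightarrow> \<bar>\<kappa> d\<bar> \<le> \<bar>integral\<^sup>L lborel f\<bar> / (real d)\<^sup>2"
proof -
  obtain r1 r2 where r: "r = (r1, r2)" by fastforce
  obtain C where C: "\<And>X d m s. X > 0 \<Longrightarrow> d > 0 \<Longrightarrow> d \<le> m \<Longrightarrow> m \<le> d * M \<Longrightarrow> d dvd m \<Longrightarrow>
      d dvd fst s \<Longrightarrow> d dvd snd s \<Longrightarrow>
      \<bar>scaled_sum (class_box m s (R * X) - {(0, 0)}) X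
        - integral\<^sup>L lborel f / (real_of_int m)\<^sup>2 * X\<^sup>2\<bar> \<le> C * (X / real_of_int d) powr (3/2)"
    and C0: "C \<ge> 0"
    using sublattice_sum[OF M] by blast
  define P where "P d u v \<longleftrightarrow> [u = r1] (mod M) \<and> [v = r2] (mod M) \<and> int d dvd u \<and> int d dvd v" for d u v
  \<comment> \<open>The value is 0 for incompatible conditions, when no lattice point is
    counted.\<close>
  define \<kappa> where "\<kappa> d = (if \<exists>u v. P d u v then integral\<^sup>L lborel f / (real_of_int (lcm (int d) M))\<^sup>2 else 0)" for d
  show ?thesis
  proof
    show "C \<ge> 0" by (rule C0)
  next
    fix d :: nat assume d: "d > 0"
    have "int d \<le> lcm (int d) M" using d M by (intro zdvd_imp_le) (auto intro: lcm_pos_int)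
    then have "real d \<le> real_of_int (lcm (int d) M)" by linarith
    then have "(real d)\<^sup>2 \<le> (real_of_int (lcm (int d) M))\<^sup>2"
      by (intro power_mono) auto
    moreover have "(real d)\<^sup>2 > 0" using d by simp
    ultimately show "\<bar>\<kappa> d\<bar> \<le> \<bar>integral\<^sup>L lborel f\<bar> / (real d)\<^sup>2"
      using frac_le[of "\<bar>integral\<^sup>L lborel f\<bar>" "\<bar>integral\<^sup>L lborel f\<bar>" "(real d)\<^sup>2"]
      by (simp add: \<kappa>_def)
  next
    fix X :: real and d :: nat assume X: "X > 0" and d: "d > 0"
    define Z where "Z = {z \<in> class_box M r (R * X) - {(0, 0)}. int d dvd fst z \<and> int d dvd snd z}"
    show "\<bar>scaled_sum Z X - \<kappa> d * X\<^sup>2\<bar> \<le> C * (X / real d) powr (3/2)"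
    proof (cases "\<exists>u v. P d u v")
      case False
      then have "Z = {}" by (auto simp: Z_def class_box_def P_def r)
      then show ?thesis using False C0 X by (simp add: \<kappa>_def scaled_sum_def)
    next
      case True
      then obtain s1 s2 where s: "P d s1 s2" by blast
      define m where "m = lcm (int d) M"
      have cong: "([u = r1] (mod M) \<and> int d dvd u) \<longleftrightarrow> [u = s1] (mod m)" 
        if "[s1 = r1] (mod M)" "int d dvd s1" for u s1 r1
      proof
        assume "[u = r1] (mod M) \<and> int d dvd u"
        then have "[u = s1] (mod M)" "[u = s1] (mod int d)"
          using that cong_trans[OF _ cong_sym] by (blast, simp add: cong_iff_dvd_diff)
        then show "[u = s1] (mod m)" unfolding m_def by (metis cong_cong_lcm_int)
      next
        assume "[u = s1] (mod m)"
        then have "[u = s1] (mod M)" "[u = s1] (mod int d)"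
          by (auto simp: m_def intro: cong_dvd_modulus)
        then show "[u = r1] (mod M) \<and> int d dvd u"
          using that by (auto intro: cong_trans simp: cong_dvd_iff)
      qed
      have "Z = class_box m (s1, s2) (R * X) - {(0, 0)}"
        using s cong[of s1 r1] cong[of s2 r2] by (auto simp: Z_def class_box_def P_def r)
      moreover have "int d \<le> m" unfolding m_def using d M by (intro zdvd_imp_le) (auto intro: lcm_pos_int)
      moreover have "m \<le> int d * M" unfolding m_def using d M by (intro zdvd_imp_le) auto
      ultimately show ?thesis
        using C[OF X, of "int d" m "(s1, s2)"] s d True by (simp add: m_def \<kappa>_def P_def)
    qed
  qed
qed

definition primitive_class_sum :: "int \<Rightarrow> int \<times> int \<Rightarrow> real \<Rightarrow> real" where
  "primitive_class_sum M r X =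
     scaled_sum {z \<in> class_box M r (R * X). coprime (fst z) (snd z)} X"

text \<open>The gcd of a nonzero point of the box is at most \<open>R * X\<close>, so the sum over
  \<open>d\<close> may stop at any such \<open>N\<close>. The origin is divisible by every
  \<open>d\<close> and has to be removed first.\<close>

lemma primitive_class_sum_moebius:
  assumes X: "X > 0" and N: "real N \<ge> R * X"
  shows "primitive_class_sum M r X = (\<Sum>d=1..N. moebius_mu d *
      scaled_sum {z \<in> class_box M r (R * X) - {(0, 0)}. int d dvd fst z \<and> int d dvd snd z} X)"
proof -
  define Z where "Z = class_box M r (R * X) - {(0, 0)}"
  define h where "h z = f (fst z / X, snd z / X)" for z :: "int \<times> int"
  have finZ: "finite Z" by (simp add: Z_def)
  have mu: "(\<Sum>d=1..N. if int d dvd fst z \<and> int d dvd snd z then moebius_mu d else 0) =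
      (if coprime (fst z) (snd z) then 1 else 0)" if z: "z \<in> Z" for z
  proof -
    define n where "n = nat (gcd (fst z) (snd z))"
    have n: "int n = gcd (fst z) (snd z)" by (simp add: n_def)
    have "z \<noteq> (0, 0)" using z by (simp add: Z_def)
    then have "int n \<noteq> 0" unfolding n by (cases z) auto
    then have "n > 0" by simp
    have "n \<le> N"
    proof -
      have "int n dvd fst z" "int n dvd snd z" by (simp_all add: n)
      then have "int n \<le> max \<bar>fst z\<bar> \<bar>snd z\<bar>"
        using \<open>z \<noteq> (0, 0)\<close> dvd_imp_le_int[of "fst z" "int n"] dvd_imp_le_int[of "snd z" "int n"]
        by (cases "fst z = 0") (auto simp: prod_eq_iff)
      moreover have "\<bar>real_of_int (fst z)\<bar> \<le> N" "\<bar>real_of_int (snd z)\<bar> \<le> N"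
        using z N by (auto simp: Z_def class_box_def lattice_box_def)
      ultimately show ?thesis by linarith
    qed
    have iff: "int d dvd fst z \<and> int d dvd snd z \<longleftrightarrow> d dvd n" for d
      by (simp flip: int_dvd_int_iff add: n)
    have "(\<Sum>d=1..N. if int d dvd fst z \<and> int d dvd snd z then moebius_mu d else 0) =
        (\<Sum>d\<in>{d \<in> {1..N}. d dvd n}. moebius_mu d)"
      unfolding iff by (intro sum.inter_filter[symmetric]) auto
    also have "{d \<in> {1..N}. d dvd n} = {d. d dvd n}"
      using dvd_imp_le[OF _ \<open>n > 0\<close>] dvd_pos_nat[OF \<open>n > 0\<close>] \<open>n \<le> N\<close>
      by (force simp: Suc_le_eq)
    also have "(\<Sum>d | d dvd n. moebius_mu d) = (if n = 1 then 1 else 0)"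
      by (rule sum_moebius_mu_divisors) fact
    also have "n = 1 \<longleftrightarrow> coprime (fst z) (snd z)"
      using n by (auto simp: coprime_iff_gcd_eq_1)
    finally show ?thesis .
  qed
  \<comment> \<open>The origin is not a coprime pair, so passing to \<open>Z\<close> loses no
    term.\<close>
  have "primitive_class_sum M r X = (\<Sum>z\<in>{z \<in> Z. coprime (fst z) (snd z)}. h z)"
    unfolding primitive_class_sum_def scaled_sum_def h_def
    by (intro sum.cong) (auto simp: Z_def)
  also have "\<dots> = (\<Sum>z\<in>Z. h z * (if coprime (fst z) (snd z) then 1 else 0))"
    by (subst sum.inter_filter[OF finZ]) (auto intro!: sum.cong)
  also have "\<dots> = (\<Sum>z\<in>Z. h z * (\<Sum>d=1..N. if int d dvd fst z \<and> int d dvd snd z then moebius_mu d else 0))"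
    by (intro sum.cong refl) (subst mu, auto)
  also have "\<dots> = (\<Sum>d=1..N. \<Sum>z\<in>Z. if int d dvd fst z \<and> int d dvd snd z then moebius_mu d * h z else 0)"
    unfolding sum_distrib_left by (subst sum.swap) (auto intro!: sum.cong)
  also have "\<dots> = (\<Sum>d=1..N. moebius_mu d * (\<Sum>z | z \<in> Z \<and> int d dvd fst z \<and> int d dvd snd z. h z))"
    by (simp add: sum.inter_filter[OF finZ, symmetric] sum_distrib_left)
  finally show ?thesis by (simp add: Z_def h_def scaled_sum_def)
qed

text \<open>\<open>K\<close> is the absolutely convergent sum of
  \<open>moebius_mu d * \<kappa> d\<close>, and the errors for the single \<open>d\<close> are
  dominated by the convergent series of \<open>d powr (-3/2)\<close>.\<close>

lemma primitive_class_sum_asymptotics: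
  assumes M: "M > 0"
  obtains K C where "\<And>X. X > 0 \<Longrightarrow> \<bar>primitive_class_sum M r X - K * X\<^sup>2\<bar> \<le> C * X powr (3/2)"
proof -
  let ?T = "\<lambda>X d. scaled_sum {z \<in> class_box M r (R * X) - {(0, 0)}. int d dvd fst z \<and> int d dvd snd z} X"
  obtain C \<kappa> where C: "\<And>X d. X > 0 \<Longrightarrow> d > 0 \<Longrightarrow>
      \<bar>?T X d - \<kappa> d * X\<^sup>2\<bar> \<le> C * (X / real d) powr (3/2)"
    and C0: "C \<ge> 0" and \<kappa>: "\<And>d. d > 0 \<Longrightarrow> \<bar>\<kappa> d\<bar> \<le> \<bar>integral\<^sup>L lborel f\<bar> / (real d)\<^sup>2"
    by (rule divisible_class_sum[OF M, of r]) (rule that)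
  \<comment> \<open>The index is shifted so that the series start at \<open>d = 1\<close>.\<close>
  define a where "a d = moebius_mu (Suc d) * \<kappa> (Suc d)" for d
  define b where "b d = real (Suc d) powr (-3/2)" for d
  have sum_b: "summable b"
    unfolding b_def by (subst summable_Suc_iff[of "\<lambda>n. real n powr (-3/2)"]) (simp add: summable_real_powr_iff)
  have sum_a: "summable a"
  proof (rule summable_comparison_test')
    show "summable (\<lambda>d. \<bar>integral\<^sup>L lborel f\<bar> * (1 / (real (Suc d))\<^sup>2))"
      by (intro summable_mult) (subst summable_Suc_iff[of "\<lambda>n. 1 / (real n)\<^sup>2"], use inverse_power_summable[of 2] in \<open>simp add: field_simps\<close>)
    show "norm (a d) \<le> \<bar>integral\<^sup>L lborel f\<bar> * (1 / (real (Suc d))\<^sup>2)" for d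
    proof -
      have "\<bar>moebius_mu (Suc d)\<bar> * \<bar>\<kappa> (Suc d)\<bar> \<le> 1 * \<bar>\<kappa> (Suc d)\<bar>"
        by (intro mult_right_mono abs_moebius_mu_le) auto
      then show ?thesis using \<kappa>[of "Suc d"] by (simp add: a_def abs_mult)
    qed
  qed
  show ?thesis
  proof
    fix X :: real assume X: "X > 0"
    \<comment> \<open>The truncated identity holds for every large \<open>N\<close> with the same
      error bound, so letting \<open>N\<close> tend to infinity completes the main term without an
      estimate of its tail.\<close>
    define e where "e N = primitive_class_sum M r X - (\<Sum>d<N. a d) * X\<^sup>2" for N
    have "(\<lambda>N. \<bar>e N\<bar>) \<longlonglongrightarrow> \<bar>primitive_class_sum M r X - suminf a * X\<^sup>2\<bar>"
      unfolding e_def using summable_LIMSEQ[OF sum_a] by (intro tendsto_intros)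
    moreover have "\<exists>N0. \<forall>N\<ge>N0. \<bar>e N\<bar> \<le> C * suminf b * X powr (3/2)"
    proof (intro exI allI impI)
      fix N assume "nat \<lceil>R * X\<rceil> \<le> N"
      then have N: "real N \<ge> R * X" by linarith
      have "primitive_class_sum M r X = (\<Sum>d=1..N. moebius_mu d * ?T X d)"
        by (rule primitive_class_sum_moebius[OF X N])
      also have "\<dots> = (\<Sum>d<N. moebius_mu (Suc d) * ?T X (Suc d))"
        by (rule sum.reindex_bij_witness[of _ Suc "\<lambda>d. d - 1"]) auto
      finally have "e N = (\<Sum>d<N. moebius_mu (Suc d) * (?T X (Suc d) - \<kappa> (Suc d) * X\<^sup>2))"
        by (simp only: e_def a_def sum_distrib_right sum_subtractf right_diff_distrib mult.assoc)
      then have "\<bar>e N\<bar> \<le> (\<Sum>d<N. \<bar>moebius_mu (Suc d) * (?T X (Suc d) - \<kappa> (Suc d) * X\<^sup>2)\<bar>)"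
        by (simp add: sum_abs)
      also have "\<dots> \<le> (\<Sum>d<N. C * X powr (3/2) * b d)"
      proof (rule sum_mono)
        fix d
        have "\<bar>moebius_mu (Suc d)\<bar> * \<bar>?T X (Suc d) - \<kappa> (Suc d) * X\<^sup>2\<bar> \<le> 1 * (C * (X / real (Suc d)) powr (3/2))"
          by (intro mult_mono abs_moebius_mu_le C X) auto
        also have "\<dots> = C * X powr (3/2) * b d"
          using X by (simp add: b_def powr_divide powr_minus_divide)
        finally show "\<bar>moebius_mu (Suc d) * (?T X (Suc d) - \<kappa> (Suc d) * X\<^sup>2)\<bar> \<le> C * X powr (3/2) * b d"
          by (simp add: abs_mult)
      qed
      also have "\<dots> = C * X powr (3/2) * (\<Sum>d<N. b d)" by (simp add: sum_distrib_left)
      also have "\<dots> \<le> C * X powr (3/2) * suminf b"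
        using C0 by (intro mult_left_mono sum_le_suminf sum_b) (auto simp: b_def)
      finally show "\<bar>e N\<bar> \<le> C * suminf b * X powr (3/2)" by (simp add: algebra_simps)
    qed
    ultimately show "\<bar>primitive_class_sum M r X - suminf a * X\<^sup>2\<bar> \<le> (C * suminf b) * X powr (3/2)"
      by (rule LIMSEQ_le_const2)
  qed
qed

end

section \<open>Reduction of an isotropic form to a conic\<close>

text \<open>The polar form of \<open>qform A\<close>. No division by 2 occurs, so it is integral for
  every \<open>A\<close>.\<close>

definition bform :: "int^3^3 \<Rightarrow> int^3 \<Rightarrow> int^3 \<Rightarrow> int" where
  "bform A x y = (\<Sum>i\<in>UNIV. (hessian A *v x) $ i * y $ i)"

definition int_cross :: "int^3 \<Rightarrow> int^3 \<Rightarrow> int^3" where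
  "int_cross a b = vector [a$2 * b$3 - a$3 * b$2, a$3 * b$1 - a$1 * b$3, a$1 * b$2 - a$2 * b$1]"

lemma int_cross_nth [simp]:
  "int_cross a b $ 1 = a$2 * b$3 - a$3 * b$2" "int_cross a b $ 2 = a$3 * b$1 - a$1 * b$3"
  "int_cross a b $ 3 = a$1 * b$2 - a$2 * b$1"
  by (simp_all add: int_cross_def)

lemma bform_commute: "bform A x y = bform A y x"
  by (simp add: bform_def hessian_def matrix_vector_mult_def transpose_def sum_3 algebra_simps)

lemma bform_self: "bform A x x = 2 * qform A x"
  by (simp add: bform_def qform_def hessian_def matrix_vector_mult_def transpose_def sum_3 algebra_simps)

lemma qform_add: "qform A (x + y) = qform A x + bform A x y + qform A (y :: int^3)"
  by (simp add: bform_def qform_def hessian_def matrix_vector_mult_def transpose_def sum_3 algebra_simps)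

lemma qform_scale: "qform A (c *s x) = c\<^sup>2 * qform A x"
  by (simp add: qform_def sum_distrib_left power2_eq_square algebra_simps)

lemma bform_scale [simp]:
  "bform A (c *s x) y = c * bform A x y" "bform A x (c *s y) = c * bform A x y"
  by (simp_all add: bform_def matrix_vector_mult_def sum_3 algebra_simps)

lemma bform_add_left: "bform A (x + y) z = bform A x z + bform A y z"
  by (simp add: bform_def matrix_vector_mult_def sum_3 algebra_simps)

lemma bform_add_right: "bform A x (y + z) = bform A x y + bform A x z"
  by (simp add: bform_def sum_3 algebra_simps)

text \<open>The adjugate is the integral substitute for the inverse.\<close>

lemma adjugate_3:
  fixes P :: "int^3^3"
  obtains Q where "P ** Q = mat (det P)" "Q ** P = mat (det P)"
proof
  \<comment> \<open>The minor of rows \<open>i\<close>, \<open>k\<close> and columns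
    \<open>j\<close>, \<open>l\<close>; the order of the columns supplies the cofactor sign.\<close>
  define c where "c i j k l = P$i$j * P$k$l - P$i$l * P$k$j" for i j k l
  define Q :: "int^3^3" where "Q = vector [vector [c 2 2 3 3, c 1 3 3 2, c 1 2 2 3],
    vector [c 2 3 3 1, c 1 1 3 3, c 1 3 2 1], vector [c 2 1 3 2, c 1 2 3 1, c 1 1 2 2]]"
  show "P ** Q = mat (det P)" "Q ** P = mat (det P)"
    by (simp_all add: Q_def c_def vec_eq_iff forall_3 matrix_matrix_mult_def sum_3 mat_def det_3 algebra_simps)
qed

lemma mat_vector_mult: "mat c *v x = c *s (x :: int^3)"
  by (simp add: matrix_vector_mult_def mat_def vec_eq_iff sum_3 forall_3)

text \<open>Multiplication by the adjugate shows that \<open>hessian A\<close> is injective, and a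
  standard basis vector detects a nonzero coordinate of the image of \<open>x\<close>.\<close>

lemma exists_bform_nonzero:
  assumes "nondegenerate A" "x \<noteq> 0"
  obtains y where "bform A x y \<noteq> 0"
proof -
  have "hessian A *v x \<noteq> 0"
  proof
    assume H: "hessian A *v x = 0"
    obtain Q where "Q ** hessian A = mat (disc A)"
      using adjugate_3[of "hessian A"] unfolding disc_def by blast
    then have "disc A *s x = Q *v (hessian A *v x)"
      by (metis matrix_vector_mul_assoc mat_vector_mult)
    then have "disc A *s x = 0" by (simp add: H)
    then show False using assms by (auto simp: nondegenerate_def vec_eq_iff)
  qed
  then obtain i where i: "(hessian A *v x) $ i \<noteq> 0" by (auto simp: vec_eq_iff)
  show ?thesis
  proof
    show "bform A x (axis i 1) \<noteq> 0"
      using i by (simp add: bform_def axis_def if_distrib cong: if_cong)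
  qed
qed

lemma hyperbolic_pair:
  assumes "nondegenerate A" "x \<noteq> 0" "qform A x = 0"
  obtains y where "qform A y = 0" "bform A x y \<noteq> 0"
proof -
  obtain z where z: "bform A x z \<noteq> 0" using exists_bform_nonzero[OF assms(1,2)] .
  \<comment> \<open>The projective line through \<open>x\<close> and \<open>z\<close> meets the
    conic in a second point, which is \<open>y\<close>.\<close>
  define y where "y = bform A x z *s z + (- qform A z) *s x"
  have "qform A y = 0"
    unfolding y_def qform_add qform_scale bform_scale
    using assms(3) bform_commute[of A z x] by (simp add: power2_eq_square)
  moreover have "bform A x y = bform A x z * bform A x z"
    unfolding y_def using assms(3) bform_commute[of A x] 
    by (simp add: bform_add_left bform_self)
  ultimately show ?thesis using z that by simp
qed

definition int_dot :: "int^3 \<Rightarrow> int^3 \<Rightarrow> int" where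
  "int_dot a b = a$1 * b$1 + a$2 * b$2 + a$3 * b$3"

text \<open>This is the Binet-Cauchy identity.\<close>

lemma int_dot_cross_cross:
  "int_dot (int_cross a b) (int_cross c d) = int_dot a c * int_dot b d - int_dot a d * int_dot b c"
  by (simp add: int_dot_def int_cross_def algebra_simps)

lemma bform_eq_int_dot: "bform A x y = int_dot (hessian A *v x) y"
  by (simp add: bform_def int_dot_def sum_3)

lemma int_dot_commute: "int_dot a b = int_dot b a"
  by (simp add: int_dot_def algebra_simps)

text \<open>The triple product is the determinant of the matrix with these three rows, and applying
  \<open>H\<close> to every row multiplies that matrix by \<open>transpose H\<close>.\<close>

lemma int_dot_cross_mult:
  "int_dot (int_cross (H *v x) (H *v y)) (H *v z) = det H * int_dot (int_cross x y) z"
proof -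
  have triple: "int_dot (int_cross a b) c = det (vector [a, b, c])" for a b c
    by (simp add: int_dot_def det_3 algebra_simps)
  have "vector [H *v x, H *v y, H *v z] = (vector [x, y, z] :: int^3^3) ** transpose H"
    unfolding vec_eq_iff
  proof (intro allI)
    fix i j :: 3
    show "vector [H *v x, H *v y, H *v z] $ i $ j = ((vector [x, y, z] :: int^3^3) ** transpose H) $ i $ j"
      using exhaust_3[of i]
      by (auto simp: matrix_matrix_mult_def matrix_vector_mult_def transpose_def mult.commute)
  qed
  then show ?thesis by (simp add: triple det_mul det_transpose mult.commute)
qed

text \<open>The third vector of the basis spans the orthogonal complement of a hyperbolic plane.\<close>

lemma orthogonal_complement:
  assumes "qform A x = 0" "qform A y = 0"
  defines "z \<equiv> int_cross (hessian A *v x) (hessian A *v y)"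
  shows "bform A x z = 0" "bform A y z = 0"
    and "2 * qform A z = - (bform A x y)\<^sup>2 * disc A"
    and "int_dot (int_cross x y) z = - (bform A x y)\<^sup>2"
proof -
  show "bform A x z = 0" "bform A y z = 0"
    by (simp_all add: z_def bform_eq_int_dot int_dot_def int_cross_def algebra_simps)
  \<comment> \<open>In the Binet-Cauchy identity only the cross term survives, because
    \<open>x\<close> and \<open>y\<close> are zeros of the form.\<close>
  show *: "int_dot (int_cross x y) z = - (bform A x y)\<^sup>2"
    using assms(1,2) bform_self[of A x] bform_self[of A y] bform_commute[of A x y]
    by (simp add: z_def int_dot_cross_cross bform_eq_int_dot int_dot_commute power2_eq_square)
  \<comment> \<open>This is the triple product of the images of \<open>x\<close>, \<open>y\<close>,
    \<open>z\<close> under the Hessian, from which the determinant factors out.\<close>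
  have "2 * qform A z = int_dot z (hessian A *v z)"
    by (simp add: bform_self[symmetric] bform_eq_int_dot int_dot_commute)
  also have "\<dots> = disc A * int_dot (int_cross x y) z"
    unfolding disc_def by (subst (1) z_def) (rule int_dot_cross_mult)
  also have "\<dots> = - (bform A x y)\<^sup>2 * disc A" by (simp add: *)
  finally show "2 * qform A z = - (bform A x y)\<^sup>2 * disc A" .
qed

text \<open>\<open>Q\<close> is \<open>D\<close> times the inverse of \<open>P\<close>, which keeps
  every argument over the integers. The scale factors arising in the parametrization are divisors of
  \<open>D\<close>.\<close>

locale conic_chart =
  fixes A P Q :: "int^3^3" and D m :: int
  assumes D_nonzero: "D \<noteq> 0" and m_nonzero: "m \<noteq> 0"
    and PQ: "P ** Q = mat D" and QP: "Q ** P = mat D"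
    and qform_chart: "qform A (P *v y) = m * (y$1 * y$3 - (y$2)\<^sup>2)"

text \<open>Over the rationals an isotropic form is similar to \<open>y\<^sub>1 y\<^sub>3 - y\<^sub>2\<^sup>2\<close>: in a basis \<open>x, y, z\<close> as above it
  reads \<open>\<beta> s t + a r\<^sup>2\<close>, and \<open>s = - a \<beta> y\<^sub>1, t = y\<^sub>3, r = \<beta> y\<^sub>2\<close> makes it \<open>- a \<beta>\<^sup>2 (y\<^sub>1 y\<^sub>3 - y\<^sub>2\<^sup>2)\<close>.\<close>

lemma isotropic_similar_conic:
  fixes x :: "int^3"
  assumes A: "nondegenerate A" and x: "x \<noteq> 0" "qform A x = 0"
  obtains P Q D m where "conic_chart A P Q D m"
proof -
  obtain y where y: "qform A y = 0" "bform A x y \<noteq> 0"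
    using hyperbolic_pair[OF A x] by blast
  define z where "z = int_cross (hessian A *v x) (hessian A *v y)"
  define \<beta> where "\<beta> = bform A x y"
  define a where "a = qform A z"
  have z: "bform A x z = 0" "bform A y z = 0" "2 * a = - \<beta>\<^sup>2 * disc A" "int_dot (int_cross x y) z = - \<beta>\<^sup>2"
    using orthogonal_complement[OF x(2) y(1)] by (simp_all add: z_def \<beta>_def a_def)
  have \<beta>: "\<beta> \<noteq> 0" using y by (simp add: \<beta>_def)
  have a: "a \<noteq> 0" using z(3) \<beta> A by (auto simp: nondegenerate_def)
  define P :: "int^3^3" where "P = (\<chi> i. vector [- a * \<beta> * x$i, \<beta> * z$i, y$i])"
  have P: "P *v v = (- a * \<beta> * v$1) *s x + (v$3 *s y + (\<beta> * v$2) *s z)" for v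
    by (simp add: P_def vec_eq_iff matrix_vector_mult_def sum_3 algebra_simps)
  \<comment> \<open>Listing \<open>z\<close> before \<open>y\<close> absorbs the sign of the first
    column. The triple product is \<open>- \<beta>\<^sup>2\<close>, so the determinant is
    nonzero.\<close>
  have "det P = a * \<beta>\<^sup>2 * int_dot (int_cross x y) z"
    by (simp add: det_3 P_def int_dot_def int_cross_def power2_eq_square algebra_simps)
  then have D: "det P \<noteq> 0" using z a \<beta> by simp
  obtain Q where Q: "P ** Q = mat (det P)" "Q ** P = mat (det P)" by (rule adjugate_3)
  have "qform A (P *v v) = - a * \<beta>\<^sup>2 * (v$1 * v$3 - (v$2)\<^sup>2)" for v
  proof -
    have "qform A (P *v v) = (- a * \<beta> * v$1) * v$3 * \<beta> + (\<beta> * v$2)\<^sup>2 * a"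
      unfolding P qform_add qform_scale using x(2) y(1) z(1,2)
      by (simp add: bform_add_right flip: \<beta>_def a_def)
    then show ?thesis by (simp add: power2_eq_square algebra_simps)
  qed
  then have "conic_chart A P Q (det P) (- a * \<beta>\<^sup>2)"
    by unfold_locales (use D Q a \<beta> in simp_all)
  then show ?thesis by (rule that)
qed

text \<open>Dividing by \<open>g = gcd a b\<close> leaves \<open>u * c = g * v\<^sup>2\<close> with
  \<open>u\<close>, \<open>v\<close> coprime. Hence \<open>u\<close> divides \<open>g\<close>, and
  the quotient is the scale \<open>h\<close>, which may be negative.\<close>

lemma conic_point:
  fixes a b c :: int
  assumes "a * c = b\<^sup>2" "(a, b, c) \<noteq> (0, 0, 0)"
  obtains h u v where "coprime u v" "h \<noteq> 0" "a = h * u\<^sup>2" "b = h * (u * v)" "c = h * v\<^sup>2"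
proof (cases "a = 0")
  case True
  \<comment> \<open>Here \<open>b = 0\<close> as well, so the point is \<open>c\<close> times the
    image of the pair \<open>(0, 1)\<close>.\<close>
  then show ?thesis using assms that[of 0 1 c] by auto
next
  case False
  define g where "g = gcd a b"
  have g: "g \<noteq> 0" using False by (simp add: g_def)
  obtain u v where uv: "a = u * g" "b = v * g" "coprime u v"
    using gcd_coprime_exists[of a b] g unfolding g_def by blast
  have "u * c * g = (g * v\<^sup>2) * g" using assms(1) uv(1,2) by (simp add: power2_eq_square algebra_simps)
  then have eq: "u * c = g * v\<^sup>2" using g by simp
  then have "u dvd g * v\<^sup>2" by (metis dvd_triv_left)
  then have "u dvd g" using uv(3) by (simp add: coprime_dvd_mult_left_iff)
  then obtain h where h: "g = u * h" by blast
  have u: "u \<noteq> 0" using False uv by auto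
  have "c = h * v\<^sup>2" using eq h u by (simp add: algebra_simps)
  then show ?thesis using that[of u v h] uv h g by (auto simp: power2_eq_square algebra_simps)
qed

section \<open>Parametrization of the primitive zeros\<close>

lemma primitive_iff: "primitive x \<longleftrightarrow> (\<forall>q. (\<forall>i. q dvd x $ i) \<longrightarrow> q dvd 1)"
proof -
  have "q dvd gcd (x$1) (gcd (x$2) (x$3)) \<longleftrightarrow> (\<forall>i. q dvd x $ i)" for q
    by (auto simp: forall_3)
  then show ?thesis
    unfolding primitive_def by (metis dvd_refl gcd_ge_0_int is_unit_gcd_iff zdvd1_eq abs_of_nonneg)
qed

text \<open>The gcd of the products \<open>c * x $ i\<close> is \<open>c\<close> up to sign.\<close>

lemma primitive_dvd_cancel:
  assumes "primitive x" "\<And>i. h dvd c * x $ i"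
  shows "h dvd c"
proof -
  have step: "h dvd c * gcd a b" if "h dvd c * a" "h dvd c * b" for a b
    using gcd_greatest[OF that] by (simp add: gcd_mult_left)
  have "h dvd c * gcd (x$1) (gcd (x$2) (x$3))" by (intro step assms(2))
  then show ?thesis using assms(1) by (simp only: primitive_def mult_1_right)
qed

lemma coprime_squares_dvd_cancel:
  fixes u v :: int
  assumes "coprime u v" "q dvd c * u\<^sup>2" "q dvd c * v\<^sup>2"
  shows "q dvd c"
proof -
  have "q dvd gcd (c * u\<^sup>2) (c * v\<^sup>2)" using assms by simp
  moreover have "gcd (u\<^sup>2) (v\<^sup>2) = 1" using assms(1) by simp
  ultimately show ?thesis by (simp add: gcd_mult_left)
qed

definition veronese :: "int \<Rightarrow> int \<Rightarrow> int^3" where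
  "veronese u v = vector [u\<^sup>2, u * v, v\<^sup>2]"

lemma veronese_nth [simp]:
  "veronese u v $ 1 = u\<^sup>2" "veronese u v $ 2 = u * v" "veronese u v $ 3 = v\<^sup>2"
  by (simp_all add: veronese_def)

lemma matrix_scale_vec: "(M::int^3^3) *v (c *s x) = c *s (M *v x)"
  by (simp add: vec_eq_iff matrix_vector_mult_def sum_3 algebra_simps)

context conic_chart
begin

lemma PQ_vec: "P *v (Q *v x) = D *s x" and QP_vec: "Q *v (P *v x) = D *s x"
  by (simp_all add: matrix_vector_mul_assoc PQ QP mat_vector_mult)

lemma chart_point:
  assumes "P *v veronese u v = g *s x" "g \<noteq> 0"
  shows "qform A x = 0"
proof -
  have "g\<^sup>2 * qform A x = 0"
    using qform_chart[of "veronese u v"] by (simp add: assms(1) qform_scale power2_eq_square)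
  then show ?thesis using assms(2) by simp
qed

text \<open>\<open>P\<close> maps \<open>Q *v x\<close> to \<open>D *s x\<close>, so
  \<open>Q *v x\<close> lies on the conic and is \<open>h\<close> times a Veronese vector.
  Primitivity of \<open>x\<close> forces \<open>h\<close> to divide \<open>D\<close>, and
  \<open>g\<close> is the cofactor; thus only finitely many scales occur.\<close>

lemma chart_surjective:
  assumes "primitive x" "qform A x = 0"
  obtains g u v where "g dvd D" "coprime u v" "P *v veronese u v = g *s x"
proof -
  define y where "y = Q *v x"
  have Py: "P *v y = D *s x" by (simp add: y_def PQ_vec)
  have "m * (y$1 * y$3 - (y$2)\<^sup>2) = D\<^sup>2 * qform A x"
    unfolding qform_chart[symmetric] Py by (rule qform_scale)
  then have "y$1 * y$3 = (y$2)\<^sup>2" using assms(2) m_nonzero by simp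
  moreover have "x \<noteq> 0" using assms(1) by (auto simp: primitive_def)
  then have "y \<noteq> 0" using Py D_nonzero by auto
  then have "(y$1, y$2, y$3) \<noteq> (0, 0, 0)" by (auto simp: vec_eq_iff forall_3)
  ultimately obtain h u v where huv: "coprime u v" "h \<noteq> 0" "y$1 = h * u\<^sup>2" "y$2 = h * (u * v)" "y$3 = h * v\<^sup>2"
    by (rule conic_point)
  have y: "y = h *s veronese u v" using huv by (simp add: vec_eq_iff forall_3)
  have eq: "h *s (P *v veronese u v) = D *s x" using Py by (simp add: y matrix_scale_vec)
  have "h dvd D" 
  proof (rule primitive_dvd_cancel[OF assms(1)])
    fix i show "h dvd D * x $ i" using arg_cong[OF eq, of "\<lambda>z. z $ i"] by (metis dvd_triv_left vector_smult_component)
  qed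
  then obtain g where g: "D = h * g" by blast
  have "h *s (P *v veronese u v) = h *s (g *s x)" using eq by (simp add: g)
  then have "P *v veronese u v = g *s x" using huv(2) by (simp add: vec_eq_iff)
  then show ?thesis using that[of g u v] huv(1) g by simp
qed

text \<open>Applying \<open>Q\<close> eliminates \<open>x\<close> and leaves two proportional
  Veronese vectors. Both come from coprime pairs, so \<open>g\<close> and \<open>g'\<close> divide
  each other.\<close>

lemma chart_fibre:
  assumes "P *v veronese u v = g *s x" "P *v veronese u' v' = g' *s x"
    and "coprime u v" "coprime u' v'" "x \<noteq> 0"
  shows "g = g' \<and> ((u', v') = (u, v) \<or> (u', v') = (- u, - v))"
proof -
  have *: "D *s veronese u v = g *s (Q *v x)" "D *s veronese u' v' = g' *s (Q *v x)"
    by (simp_all add: assms(1,2) matrix_scale_vec flip: QP_vec)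
  have "D *s (g' *s veronese u v) = g' *s (D *s veronese u v)" by (simp add: mult.commute)
  also have "\<dots> = g *s (D *s veronese u' v')" unfolding * by (simp add: mult.commute)
  also have "\<dots> = D *s (g *s veronese u' v')" by (simp add: mult.commute)
  finally have "g' *s veronese u v = g *s veronese u' v'" using D_nonzero by (simp add: vec_eq_iff)
  then have e: "g' * u\<^sup>2 = g * u'\<^sup>2" "g' * (u * v) = g * (u' * v')" "g' * v\<^sup>2 = g * v'\<^sup>2"
    by (simp_all add: vec_eq_iff forall_3)
  have "g dvd g'" using coprime_squares_dvd_cancel[OF assms(3), of g g'] e by simp
  moreover have "g' dvd g" using coprime_squares_dvd_cancel[OF assms(4), of g' g] by (simp flip: e)
  ultimately have abs: "\<bar>g\<bar> = \<bar>g'\<bar>" by (rule zdvd_antisym_abs)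
  have "veronese u v \<noteq> 0" using assms(3) by (auto simp: vec_eq_iff forall_3)
  then have g: "g \<noteq> 0" using * D_nonzero by (auto simp: vec_eq_iff)
  \<comment> \<open>With opposite signs all of \<open>u\<close>, \<open>u'\<close>,
    \<open>v\<close>, \<open>v'\<close> would vanish, since squares are nonnegative.\<close>
  have "g = g'"
  proof (rule ccontr)
    assume "g \<noteq> g'"
    then have "g' = - g" using abs by auto
    then have "g * (u\<^sup>2 + u'\<^sup>2) = 0" "g * (v\<^sup>2 + v'\<^sup>2) = 0"
      using e(1,3) by (simp_all add: distrib_left)
    then show False using g assms(3) by (simp add: sum_power2_eq_zero_iff)
  qed
  then have e': "u\<^sup>2 = u'\<^sup>2" "u * v = u' * v'" "v\<^sup>2 = v'\<^sup>2" using e g by auto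
  then have "u' = u \<or> u' = - u" "v' = v \<or> v' = - v" by (auto simp: power2_eq_iff)
  \<comment> \<open>The middle coordinate excludes a sign change in only one of two nonzero
    entries.\<close>
  then have "(u', v') = (u, v) \<or> (u', v') = (- u, - v)" using e'(2) by auto
  then show ?thesis using \<open>g = g'\<close> by blast
qed

text \<open>For \<open>g \<noteq> 0\<close> the vector \<open>x\<close> is determined by
  \<open>g\<close> and the pair, so this is a condition on the pair.\<close>

definition admissible :: "nat \<Rightarrow> int^3 \<Rightarrow> int \<Rightarrow> int \<Rightarrow> int \<Rightarrow> bool" where
  "admissible L \<Gamma> g u v \<longleftrightarrow>
     (\<exists>x. primitive x \<and> vec_cong x \<Gamma> (int L) \<and> P *v veronese u v = g *s x)"

text \<open>Write \<open>D = g * e\<close>. Moving the pair by multiples of \<open>D * L\<close>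
  moves its image by a multiple of \<open>g * e * L\<close>, hence \<open>x\<close> by a multiple of
  \<open>e * L\<close>. The factor \<open>L\<close> preserves the congruence and the factor
  \<open>e\<close> preserves primitivity.\<close>

lemma admissible_periodic:
  assumes g: "g dvd D" and adm: "admissible L \<Gamma> g u v" and cop: "coprime u' v'"
    and u: "[u' = u] (mod D * int L)" and v: "[v' = v] (mod D * int L)"
  shows "admissible L \<Gamma> g u' v'"
proof -
  obtain x where x: "primitive x" "vec_cong x \<Gamma> (int L)" "P *v veronese u v = g *s x"
    using adm by (auto simp: admissible_def)
  obtain e where e: "D = g * e" using g by blast
  have "[veronese u' v' $ i = veronese u v $ i] (mod D * int L)" for i
    using exhaust_3[of i] by (auto intro!: cong_mult cong_pow u v)
  then have "\<exists>k. veronese u' v' $ i = veronese u v $ i + D * int L * k" for i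
    by (metis cong_iff_lin cong_sym)
  then obtain k where "\<And>i. veronese u' v' $ i = veronese u v $ i + D * int L * k i" by metis
  then have "veronese u' v' = veronese u v + (D * int L) *s vec_lambda k"
    by (simp add: vec_eq_iff)
  then have "P *v veronese u' v' = g *s x + (D * int L) *s (P *v vec_lambda k)"
    by (simp add: matrix_vector_right_distrib matrix_scale_vec x(3))
  also have "\<dots> = g *s (x + (e * int L) *s (P *v vec_lambda k))"
    by (simp add: vec_eq_iff e algebra_simps)
  finally obtain x' where x': "P *v veronese u' v' = g *s x'" "x' = x + (e * int L) *s (P *v vec_lambda k)"
    by blast
  have "vec_cong x' x (int L)" by (simp add: vec_cong_def x'(2) cong_iff_dvd_diff)
  then have "vec_cong x' \<Gamma> (int L)" using x(2) unfolding vec_cong_def by (blast intro: cong_trans)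
  moreover have "primitive x'"
    unfolding primitive_iff
  proof (intro allI impI)
    fix q assume q: "\<forall>i. q dvd x' $ i"
    have g0: "g \<noteq> 0" using e D_nonzero by auto
    \<comment> \<open>Applying \<open>Q\<close> shows that a common divisor \<open>q\<close> of
      \<open>x'\<close> divides \<open>e\<close> times a primitive Veronese vector. So
      \<open>q\<close> divides \<open>e\<close>, hence \<open>x' - x\<close>, hence
      \<open>x\<close>.\<close>
    have "g *s (e *s veronese u' v') = g *s (Q *v x')"
      using QP_vec[of "veronese u' v'"] by (simp add: e x'(1) matrix_scale_vec)
    then have eq: "e *s veronese u' v' = Q *v x'" using g0 by (simp add: vec_eq_iff)
    have "q dvd (Q *v x') $ i" for i
      using q by (auto simp: matrix_vector_mult_def intro!: dvd_sum)
    then have "q dvd e * veronese u' v' $ i" for i by (metis eq vector_smult_component)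
    from this[of 1] this[of 3] have "q dvd e" using coprime_squares_dvd_cancel[OF cop, of q e] by simp
    then have "q dvd x $ i" for i
      using q[rule_format, of i] by (simp add: x'(2) dvd_add_left_iff)
    then show "q dvd 1" using x(1) by (auto simp: primitive_iff)
  qed
  ultimately show ?thesis using x'(1) unfolding admissible_def by blast
qed

end

section \<open>The weight in the chart\<close>

lemma weight_function_radius:
  assumes "weight_function w"
  obtains W where "W > 0" "\<And>t. w t \<noteq> 0 \<Longrightarrow> norm t \<le> W"
proof -
  have "bounded (closure {t. w t \<noteq> 0})"
    using assms by (auto simp: weight_function_def intro: compact_imp_bounded)
  then obtain W where W: "W > 0" "\<forall>t\<in>closure {t. w t \<noteq> 0}. norm t \<le> W"
    using bounded_pos by blast
  then have "norm t \<le> W" if "w t \<noteq> 0" for t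
    using that closure_subset[of "{t. w t \<noteq> 0}"] by auto
  then show ?thesis using W(1) that by blast
qed

lemma weight_function_differentiable:
  assumes "weight_function w"
  shows "w differentiable (at x)" "continuous_on UNIV (\<lambda>x. frechet_derivative w (at x) v)"
proof -
  have "Ck (Suc 0) w" using assms unfolding weight_function_def by blast
  then show "w differentiable (at x)" "continuous_on UNIV (\<lambda>x. frechet_derivative w (at x) v)"
    by simp_all
qed

lemma weight_function_bounded:
  assumes "weight_function w"
  obtains c where "\<And>t. \<bar>w t\<bar> \<le> c"
proof -
  have "continuous_on UNIV w"
    using weight_function_differentiable(1)[OF assms]
    by (auto intro!: differentiable_imp_continuous_on simp: differentiable_on_def)
  then have "bounded (w ` closure {t. w t \<noteq> 0})"
    using assms by (intro compact_imp_bounded compact_continuous_image)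
      (auto simp: weight_function_def intro: continuous_on_subset)
  then obtain c where c: "c > 0" "\<forall>y\<in>w ` closure {t. w t \<noteq> 0}. \<bar>y\<bar> \<le> c"
    unfolding bounded_pos by auto
  have "\<bar>w t\<bar> \<le> c" for t
    using c closure_subset[of "{t. w t \<noteq> 0}"] by (cases "w t = 0") auto
  then show ?thesis by (rule that)
qed

text \<open>The derivative is bounded on the compact support and vanishes off it, so the mean value
  inequality applies.\<close>

lemma weight_function_lipschitz:
  assumes "weight_function w"
  obtains c where "c \<ge> 0" "\<And>s t. \<bar>w s - w t\<bar> \<le> c * norm (s - t)"
proof -
  define K where "K = closure {t. w t \<noteq> 0}"
  define D where "D x = frechet_derivative w (at x)" for x
  have K: "compact K" using assms by (simp add: K_def weight_function_def)
  have D: "(w has_derivative D x) (at x)" for x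
    unfolding D_def using weight_function_differentiable(1)[OF assms]
    by (simp add: frechet_derivative_works[symmetric])
  \<comment> \<open>Continuity of the derivative is given one direction at a time, so the basis
    directions are bounded separately.\<close>
  have "\<exists>c. \<forall>x\<in>K. \<bar>D x (axis i 1)\<bar> \<le> c" for i
  proof -
    have "bounded ((\<lambda>x. D x (axis i 1)) ` K)"
      unfolding D_def
      by (intro compact_imp_bounded compact_continuous_image K continuous_on_subset[OF weight_function_differentiable(2)[OF assms]]) auto
    then show ?thesis unfolding bounded_iff by auto
  qed
  then obtain c where c: "\<And>i x. x \<in> K \<Longrightarrow> \<bar>D x (axis i 1)\<bar> \<le> c i" by metis
  define C where "C = (\<Sum>i\<in>UNIV. \<bar>c i\<bar>)"
  have C: "C \<ge> 0" by (simp add: C_def sum_nonneg)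
  have bound: "norm (D x h) \<le> C * norm h" for x h
  proof (cases "x \<in> K")
    case True
    have lin: "linear (D x)" using D[of x] by (rule has_derivative_linear)
    have "D x h = D x (\<Sum>i\<in>UNIV. h $ i *\<^sub>R axis i 1)"
      by (simp add: basis_expansion[of h, unfolded scalar_mult_eq_scaleR])
    also have "\<dots> = (\<Sum>i\<in>UNIV. h $ i * D x (axis i 1))"
      by (simp add: linear_sum[OF lin] linear_scale[OF lin])
    finally have "norm (D x h) \<le> (\<Sum>i\<in>UNIV. \<bar>h $ i * D x (axis i 1)\<bar>)" by simp
    also have "\<dots> \<le> (\<Sum>i\<in>UNIV. \<bar>c i\<bar> * norm h)"
    proof (rule sum_mono)
      fix i
      have "\<bar>D x (axis i 1)\<bar> \<le> \<bar>c i\<bar>" using c[OF True, of i] by linarith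
      then have "\<bar>D x (axis i 1)\<bar> * \<bar>h $ i\<bar> \<le> \<bar>c i\<bar> * norm h"
        by (intro mult_mono component_le_norm_cart) auto
      then show "\<bar>h $ i * D x (axis i 1)\<bar> \<le> \<bar>c i\<bar> * norm h" by (simp add: abs_mult mult.commute)
    qed
    finally show ?thesis by (simp add: C_def sum_distrib_right)
  next
    case False
    have "(w has_derivative (\<lambda>h. 0)) (at x)"
    proof (rule has_derivative_transform_within_open[of "\<lambda>x. 0"])
      show "open (- K)" by (simp add: K_def open_Compl)
      show "0 = w y" if "y \<in> - K" for y
        using that closure_subset[of "{t. w t \<noteq> 0}"] by (auto simp: K_def)
    qed (use False in auto)
    then have "D x = (\<lambda>h. 0)" using D has_derivative_unique by blast
    then show ?thesis using C by simp
  qed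
  show ?thesis
  proof (rule that[OF C])
    fix s t
    have "norm (w s - w t) \<le> C * norm (s - t)"
      by (rule differentiable_bound[of UNIV w D]) (auto intro!: onorm_le bound D)
    then show "\<bar>w s - w t\<bar> \<le> C * norm (s - t)" by simp
  qed
qed

text \<open>This serves the quadratic chart, whose Lipschitz bound is local. If one point leaves the
  box of radius \<open>R + 1\<close>, then \<open>f\<close> vanishes there, and the other point is
  outside the support too or at distance at least 1, where the bound \<open>c\<close>
  suffices.\<close>

lemma planar_weightI:
  assumes R: "R \<ge> 1"
    and supp: "\<And>a b. f (a, b) \<noteq> 0 \<Longrightarrow> \<bar>a\<bar> \<le> R \<and> \<bar>b\<bar> \<le> R"
    and bound: "\<And>a b. \<bar>f (a, b)\<bar> \<le> c"
    and lip: "\<And>a b a' b'. \<bar>a\<bar> \<le> R + 1 \<Longrightarrow> \<bar>b\<bar> \<le> R + 1 \<Longrightarrow> \<bar>a'\<bar> \<le> R + 1 \<Longrightarrow> \<bar>b'\<bar> \<le> R + 1 \<Longrightarrow>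
      \<bar>f (a, b) - f (a', b')\<bar> \<le> \<Lambda> * (\<bar>a - a'\<bar> + \<bar>b - b'\<bar>)"
  shows "planar_weight f R (max \<Lambda> c)"
proof
  fix a b a' b' :: real
  define d where "d = \<bar>a - a'\<bar> + \<bar>b - b'\<bar>"
  have c: "c \<ge> 0" using bound[of 0 0] by linarith
  have d: "d \<ge> 0" by (simp add: d_def)
  have le: "\<Lambda> * d \<le> max \<Lambda> c * d" "c * d \<le> max \<Lambda> c * d" using d by (auto intro: mult_right_mono)
  have far: "\<bar>f (x, y)\<bar> \<le> c * d" if "\<bar>x\<bar> \<le> R \<and> \<bar>y\<bar> \<le> R \<Longrightarrow> d \<ge> 1" for x y
  proof (cases "f (x, y) = 0")
    case False
    then have "c * 1 \<le> c * d" using supp that c by (intro mult_left_mono) auto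
    then show ?thesis using bound[of x y] by simp
  qed (use c d in simp)
  have "\<bar>f (a, b) - f (a', b')\<bar> \<le> max \<Lambda> c * d"
  proof (cases "(\<bar>a\<bar> \<le> R + 1 \<and> \<bar>b\<bar> \<le> R + 1) \<and> (\<bar>a'\<bar> \<le> R + 1 \<and> \<bar>b'\<bar> \<le> R + 1)")
    case True
    then have "\<bar>f (a, b) - f (a', b')\<bar> \<le> \<Lambda> * d" unfolding d_def by (intro lip) auto
    then show ?thesis using le by linarith
  next
    case False
    then consider "\<not> (\<bar>a'\<bar> \<le> R + 1 \<and> \<bar>b'\<bar> \<le> R + 1)" | "\<not> (\<bar>a\<bar> \<le> R + 1 \<and> \<bar>b\<bar> \<le> R + 1)"
      by blast
    then show ?thesis
    proof cases
      case 1
      then have "f (a', b') = 0" using supp[of a' b'] by linarith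
      moreover have "\<bar>f (a, b)\<bar> \<le> c * d" using 1 by (intro far) (auto simp: d_def)
      ultimately show ?thesis using le by simp
    next
      case 2
      then have "f (a, b) = 0" using supp[of a b] by linarith
      moreover have "\<bar>f (a', b')\<bar> \<le> c * d" using 2 by (intro far) (auto simp: d_def)
      ultimately show ?thesis using le by simp
    qed
  qed
  then show "\<bar>f (a, b) - f (a', b')\<bar> \<le> max \<Lambda> c * (\<bar>a - a'\<bar> + \<bar>b - b'\<bar>)"
    by (simp add: d_def)
qed (use R supp in auto)

context conic_chart
begin

text \<open>The pullback of \<open>w\<close> along the parametrization, extended to real points. As
  the chart is homogeneous of degree 2, dividing \<open>x\<close> by \<open>B\<close> amounts to
  dividing the pair by \<open>sqrt B\<close>.\<close>

definition chart_weight :: "(real^3 \<Rightarrow> real) \<Rightarrow> int \<Rightarrow> real \<times> real \<Rightarrow> real" where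
  "chart_weight w g = (\<lambda>(a, b). w (\<chi> i.
     (of_int (P$i$1) * a\<^sup>2 + of_int (P$i$2) * (a * b) + of_int (P$i$3) * b\<^sup>2) / of_int g))"

text \<open>\<open>Q\<close> recovers \<open>D\<close> times
  \<open>(a\<^sup>2, a * b, b\<^sup>2)\<close> from the chart, so the bounded support of
  \<open>w\<close> bounds \<open>a\<close> and \<open>b\<close>. On bounded sets the chart is
  Lipschitz, and so is \<open>w\<close>.\<close>

lemma planar_weight_chart_weight:
  assumes w: "weight_function w" and g: "g \<noteq> 0"
  shows "\<exists>R \<Lambda>. planar_weight (chart_weight w g) R \<Lambda>"
proof -
  define q :: "real \<Rightarrow> real \<Rightarrow> real^3" where
    "q a b = (\<chi> i. (of_int (P$i$1) * a\<^sup>2 + of_int (P$i$2) * (a * b) + of_int (P$i$3) * b\<^sup>2) / of_int g)" for a b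
  have f: "chart_weight w g (a, b) = w (q a b)" for a b by (simp add: chart_weight_def q_def)
  obtain W where W: "W > 0" "\<And>t. w t \<noteq> 0 \<Longrightarrow> norm t \<le> W" by (rule weight_function_radius[OF w]) (rule that)
  obtain c where c: "\<And>t. \<bar>w t\<bar> \<le> c" by (rule weight_function_bounded[OF w]) (rule that)
  obtain \<mu> where \<mu>: "\<mu> \<ge> 0" "\<And>s t. \<bar>w s - w t\<bar> \<le> \<mu> * norm (s - t)" by (rule weight_function_lipschitz[OF w]) (rule that)
  \<comment> \<open>\<open>S\<close> bounds every coordinate of \<open>Q\<close> applied to
    \<open>g\<close> times a vector of norm at most \<open>W\<close>. Adding 1 gives
    \<open>R \<ge> 1\<close> and \<open>S \<le> R\<^sup>2\<close>, so
    \<open>a\<^sup>2 \<le> S\<close> yields \<open>\<bar>a\<bar> \<le> R\<close>.\<close>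
  define S where "S = (\<Sum>i\<in>UNIV. \<Sum>j\<in>UNIV. \<bar>real_of_int (Q$i$j)\<bar> * (\<bar>of_int g\<bar> * W))"
  define R where "R = 1 + S"
  have S: "S \<ge> 0" using W by (auto simp: S_def intro!: sum_nonneg)
  have g1: "\<bar>real_of_int g\<bar> \<ge> 1" using g by linarith
  have inv: "(\<Sum>j\<in>UNIV. real_of_int (Q$i$j) * (of_int g * q a b $ j)) = of_int D * (vector [a\<^sup>2, a * b, b\<^sup>2] :: real^3) $ i" for a b i
  proof -
    define y where "y = (vector [a\<^sup>2, a * b, b\<^sup>2] :: real^3)"
    have "(\<Sum>j\<in>UNIV. Q$i$j * P$j$k) = (if i = k then D else 0)" for k
      using QP by (simp add: matrix_matrix_mult_def mat_def vec_eq_iff)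
    then have QPik: "(\<Sum>j\<in>UNIV. real_of_int (Q$i$j) * of_int (P$j$k)) = (if i = k then of_int D else 0)" for k
      by (metis (mono_tags, lifting) of_int_0 of_int_mult of_int_sum sum.cong)
    have "of_int g * q a b $ j = (\<Sum>k\<in>UNIV. of_int (P$j$k) * y $ k)" for j
      using g by (simp add: q_def y_def sum_3)
    then have "(\<Sum>j\<in>UNIV. real_of_int (Q$i$j) * (of_int g * q a b $ j))
        = (\<Sum>k\<in>UNIV. (\<Sum>j\<in>UNIV. real_of_int (Q$i$j) * of_int (P$j$k)) * y $ k)"
      by (simp add: sum_3 algebra_simps)
    also have "\<dots> = of_int D * y $ i"
      unfolding QPik by (simp add: if_distrib if_distribR cong: if_cong)
    finally show ?thesis by (simp add: y_def)
  qed
  have supp: "\<bar>a\<bar> \<le> R \<and> \<bar>b\<bar> \<le> R" if "w (q a b) \<noteq> 0" for a b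
  proof -
    have "\<bar>\<Sum>j\<in>UNIV. real_of_int (Q$i$j) * (of_int g * q a b $ j)\<bar> \<le> S" for i
    proof -
      have "\<bar>\<Sum>j\<in>UNIV. real_of_int (Q$i$j) * (of_int g * q a b $ j)\<bar> \<le> (\<Sum>j\<in>UNIV. \<bar>real_of_int (Q$i$j) * (of_int g * q a b $ j)\<bar>)"
        by (rule sum_abs)
      also have "\<dots> \<le> (\<Sum>j\<in>UNIV. \<bar>real_of_int (Q$i$j)\<bar> * (\<bar>of_int g\<bar> * W))"
        unfolding abs_mult
        by (intro sum_mono mult_left_mono order_trans[OF component_le_norm_cart W(2)[OF that]]) auto
      also have "\<dots> \<le> S"
        unfolding S_def using W(1) by (intro member_le_sum) (auto intro!: sum_nonneg)
      finally show ?thesis .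
    qed
    \<comment> \<open>The first and third coordinates are the ones holding \<open>a\<^sup>2\<close>
      and \<open>b\<^sup>2\<close>.\<close>
    from this[of 1] this[of 3] have "\<bar>real_of_int D\<bar> * a\<^sup>2 \<le> S" "\<bar>real_of_int D\<bar> * b\<^sup>2 \<le> S"
      unfolding inv by (simp_all add: abs_mult)
    moreover have "\<bar>real_of_int D\<bar> \<ge> 1" using D_nonzero by linarith
    ultimately have "a\<^sup>2 \<le> S" "b\<^sup>2 \<le> S"
      by (meson mult_le_cancel_right1 order_trans zero_le_power2 not_le)+
    moreover have "S \<le> R\<^sup>2" using S by (simp add: R_def power2_eq_square algebra_simps)
    ultimately have "\<bar>a\<bar>\<^sup>2 \<le> R\<^sup>2" "\<bar>b\<bar>\<^sup>2 \<le> R\<^sup>2" by simp_all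
    then show ?thesis using S by (auto intro: power2_le_imp_le simp: R_def)
  qed
  \<comment> \<open>The radius of the enlarged box in \<open>planar_weightI\<close>. In the
    Lipschitz constant \<open>2 * \<rho>\<close> comes from differences of products,
    \<open>N\<close> from the entries of \<open>P\<close>, and 3 from adding the
    coordinates.\<close>
  define \<rho> where "\<rho> = R + 1"
  define N where "N = (\<Sum>i\<in>UNIV. \<Sum>j\<in>UNIV. \<bar>real_of_int (P$i$j)\<bar>)"
  have lip: "\<bar>w (q a b) - w (q a' b')\<bar> \<le> \<mu> * (3 * (N * (2 * \<rho>))) * (\<bar>a - a'\<bar> + \<bar>b - b'\<bar>)"
    if "\<bar>a\<bar> \<le> \<rho>" "\<bar>b\<bar> \<le> \<rho>" "\<bar>a'\<bar> \<le> \<rho>" "\<bar>b'\<bar> \<le> \<rho>" for a b a' b'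
  proof -
    define d where "d = \<bar>a - a'\<bar> + \<bar>b - b'\<bar>"
    have prod: "\<bar>x * y - x' * y'\<bar> \<le> 2 * \<rho> * d"
      if "\<bar>x\<bar> \<le> \<rho>" "\<bar>y'\<bar> \<le> \<rho>" "\<bar>x - x'\<bar> \<le> d" "\<bar>y - y'\<bar> \<le> d" for x y x' y' :: real
    proof -
      have "x * y - x' * y' = x * (y - y') + (x - x') * y'" by (simp add: algebra_simps)
      also have "\<bar>\<dots>\<bar> \<le> \<bar>x\<bar> * \<bar>y - y'\<bar> + \<bar>x - x'\<bar> * \<bar>y'\<bar>"
        by (metis abs_mult abs_triangle_ineq)
      also have "\<dots> \<le> \<rho> * d + d * \<rho>" using that by (intro add_mono mult_mono) auto
      finally show ?thesis by (simp add: algebra_simps)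
    qed
    have d: "\<bar>a - a'\<bar> \<le> d" "\<bar>b - b'\<bar> \<le> d" "d \<ge> 0" by (simp_all add: d_def)
    have \<rho>: "\<rho> \<ge> 0" using S by (simp add: \<rho>_def R_def)
    have comp: "\<bar>(q a b - q a' b') $ i\<bar> \<le> N * (2 * \<rho> * d)" for i
    proof -
      define y where "y = of_int (P$i$1) * (a * a - a' * a') + of_int (P$i$2) * (a * b - a' * b') + of_int (P$i$3) * (b * b - b' * b')"
      have "(q a b - q a' b') $ i = y / of_int g"
        by (simp add: q_def y_def power2_eq_square diff_divide_distrib[symmetric] algebra_simps)
      then have "\<bar>(q a b - q a' b') $ i\<bar> = \<bar>y\<bar> / \<bar>of_int g\<bar>" by simp
      also have "\<dots> \<le> \<bar>y\<bar>" using g1 by (simp add: divide_le_eq mult_le_cancel_left1)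
      also have "\<dots> \<le> \<bar>of_int (P$i$1)\<bar> * \<bar>a * a - a' * a'\<bar> + \<bar>of_int (P$i$2)\<bar> * \<bar>a * b - a' * b'\<bar> + \<bar>of_int (P$i$3)\<bar> * \<bar>b * b - b' * b'\<bar>"
        unfolding y_def abs_mult[symmetric] by linarith
      also have "\<dots> \<le> \<bar>of_int (P$i$1)\<bar> * (2 * \<rho> * d) + \<bar>of_int (P$i$2)\<bar> * (2 * \<rho> * d) + \<bar>of_int (P$i$3)\<bar> * (2 * \<rho> * d)"
        using that d by (intro add_mono mult_left_mono prod) auto
      also have "\<dots> = (\<Sum>j\<in>UNIV. \<bar>real_of_int (P$i$j)\<bar>) * (2 * \<rho> * d)"
        by (simp add: sum_3 algebra_simps)
      also have "\<dots> \<le> N * (2 * \<rho> * d)"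
        unfolding N_def using d \<rho> by (intro mult_right_mono member_le_sum) (auto intro!: sum_nonneg)
      finally show ?thesis .
    qed
    have "norm (q a b - q a' b') \<le> (\<Sum>i\<in>UNIV. \<bar>(q a b - q a' b') $ i\<bar>)" by (rule norm_le_l1_cart)
    also have "\<dots> \<le> 3 * (N * (2 * \<rho> * d))" using comp[of 1] comp[of 2] comp[of 3] unfolding sum_3 by linarith
    finally have "\<mu> * norm (q a b - q a' b') \<le> \<mu> * (3 * (N * (2 * \<rho> * d)))" using \<mu>(1) by (rule mult_left_mono)
    then show ?thesis using \<mu>(2)[of "q a b" "q a' b'"] unfolding d_def[symmetric] by (simp add: mult.assoc)
  qed
  have "planar_weight (chart_weight w g) R (max (\<mu> * (3 * (N * (2 * \<rho>)))) c)"
    by (rule planar_weightI) (use S c supp lip in \<open>auto simp: R_def \<rho>_def f\<close>)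
  then show ?thesis by blast
qed

end

section \<open>Counting the zeros\<close>

context conic_chart
begin

lemma chart_weight_lattice_point:
  assumes "P *v veronese u v = g *s x" "g \<noteq> 0" "B > 0"
  shows "chart_weight w g (u / sqrt B, v / sqrt B) = w (\<chi> i. real_of_int (x $ i) / B)"
proof -
  have "(of_int (P$i$1) * (u / sqrt B)\<^sup>2 + of_int (P$i$2) * (u / sqrt B * (v / sqrt B)) + of_int (P$i$3) * (v / sqrt B)\<^sup>2) / of_int g
      = real_of_int (x $ i) / B" for i
  proof -
    have "g * x $ i = P$i$1 * u\<^sup>2 + P$i$2 * (u * v) + P$i$3 * v\<^sup>2"
      using arg_cong[OF assms(1), of "\<lambda>z. z $ i"] by (simp add: matrix_vector_mult_def sum_3)
    then have *: "of_int g * real_of_int (x $ i) = of_int (P$i$1) * (of_int u)\<^sup>2 + of_int (P$i$2) * (of_int u * of_int v) + of_int (P$i$3) * (of_int v)\<^sup>2"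
      by (simp only: of_int_add[symmetric] of_int_mult[symmetric] of_int_power[symmetric])
    have "sqrt B * sqrt B = B" using assms(3) by simp
    then have "(of_int (P$i$1) * (u / sqrt B)\<^sup>2 + of_int (P$i$2) * (u / sqrt B * (v / sqrt B)) + of_int (P$i$3) * (v / sqrt B)\<^sup>2)
      = (of_int g * real_of_int (x $ i)) / B"
      unfolding * by (simp add: power_divide add_divide_distrib power2_eq_square)
    then show ?thesis using assms(2) by simp
  qed
  then show ?thesis by (simp add: chart_weight_def)
qed

definition admissible_pairs :: "nat \<Rightarrow> int^3 \<Rightarrow> int \<Rightarrow> real \<Rightarrow> (int \<times> int) set" where
  "admissible_pairs L \<Gamma> g N =
     {z \<in> lattice_box N. coprime (fst z) (snd z) \<and> admissible L \<Gamma> g (fst z) (snd z)}"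

lemma finite_admissible_pairs [simp, intro]: "finite (admissible_pairs L \<Gamma> g N)"
  by (simp add: admissible_pairs_def)

text \<open>Every zero comes from exactly two pairs, opposite to each other.\<close>

lemma weighted_count_eq_chart_sum:
  assumes w: "\<And>g. g \<noteq> 0 \<Longrightarrow> planar_weight (chart_weight w g) (R g) (\<Lambda> g)" and B: "B > 0"
  shows "2 * weighted_count A w L \<Gamma> B = (\<Sum>g | g dvd D.
     planar_weight.scaled_sum (chart_weight w g) (admissible_pairs L \<Gamma> g (R g * sqrt B)) (sqrt B))"
proof -
  define E where "E g = admissible_pairs L \<Gamma> g (R g * sqrt B)" for g
  define G where "G = {g. g dvd D}"
  define \<Omega> where "\<Omega> = Sigma G E"
  \<comment> \<open>The division is exact on \<open>\<Omega>\<close>, where admissibility supplies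
    the quotient.\<close>
  define \<phi> :: "int \<times> int \<times> int \<Rightarrow> int^3" where
    "\<phi> = (\<lambda>(g, u, v). \<chi> i. (P *v veronese u v) $ i div g)"
  define Zs where "Zs = {x. primitive x \<and> qform A x = 0 \<and> vec_cong x \<Gamma> (int L)}"
  define h where "h x = w (\<chi> i. real_of_int (x $ i) / B)" for x :: "int^3"
  have g0: "g \<noteq> 0" if "g \<in> G" for g using that D_nonzero by (auto simp: G_def)
  have finG: "finite G" using D_nonzero by (simp add: G_def)
  have fin: "finite \<Omega>" using finG by (simp add: \<Omega>_def E_def)
  have \<phi>: "P *v veronese u v = g *s \<phi> (g, u, v) \<and> primitive (\<phi> (g, u, v)) \<and> vec_cong (\<phi> (g, u, v)) \<Gamma> (int L)
      \<and> coprime u v \<and> g \<noteq> 0" if "(g, u, v) \<in> \<Omega>" for g u v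
  proof -
    have g: "g \<in> G" and adm: "admissible L \<Gamma> g u v" "coprime u v"
      using that by (auto simp: \<Omega>_def E_def admissible_pairs_def)
    obtain x where x: "primitive x" "vec_cong x \<Gamma> (int L)" "P *v veronese u v = g *s x"
      using adm(1) by (auto simp: admissible_def)
    have "\<phi> (g, u, v) = x" using x(3) g0[OF g] by (simp add: \<phi>_def vec_eq_iff)
    then show ?thesis using x g0[OF g] adm(2) by simp
  qed
  have sub: "\<phi> ` \<Omega> \<subseteq> Zs"
    using \<phi> chart_point by (fastforce simp: Zs_def)
  \<comment> \<open>Zeros of weight 0 contribute nothing, so only the others need a preimage; the
    support of \<open>chart_weight\<close> then places the pair in the box.\<close>
  have sup: "x \<in> \<phi> ` \<Omega>" if x: "x \<in> Zs" "h x \<noteq> 0" for x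
  proof -
    obtain g u v where guv: "g dvd D" "coprime u v" "P *v veronese u v = g *s x"
      using chart_surjective[of x] x(1) by (auto simp: Zs_def)
    have g: "g \<in> G" "g \<noteq> 0" using guv(1) g0 by (auto simp: G_def)
    have "chart_weight w g (u / sqrt B, v / sqrt B) \<noteq> 0"
      using chart_weight_lattice_point[OF guv(3) g(2) B] x(2) by (simp add: h_def)
    then have "\<bar>u / sqrt B\<bar> \<le> R g \<and> \<bar>v / sqrt B\<bar> \<le> R g"
      using planar_weight.supported[OF w[OF g(2)]] by blast
    then have "(u, v) \<in> lattice_box (R g * sqrt B)"
      using B by (simp add: lattice_box_def field_simps)
    then have "(g, u, v) \<in> \<Omega>"
      using g(1) guv x(1) by (auto simp: \<Omega>_def E_def admissible_pairs_def admissible_def Zs_def)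
    moreover have "\<phi> (g, u, v) = x" using guv(3) g(2) by (simp add: \<phi>_def vec_eq_iff)
    ultimately show ?thesis by (metis image_eqI)
  qed
  \<comment> \<open>The opposite pair stays in \<open>\<Omega>\<close>, since the box is symmetric
    and the Veronese vector even; it is a different pair because \<open>(0, 0)\<close> is not
    coprime.\<close>
  have card: "card {e \<in> \<Omega>. \<phi> e = x} = 2" if mem: "x \<in> \<phi> ` \<Omega>" for x
  proof -
    obtain e where e: "e \<in> \<Omega>" "x = \<phi> e" using mem by blast
    obtain g u v where "e = (g, u, v)" by (cases e)
    then have guv: "(g, u, v) \<in> \<Omega>" "x = \<phi> (g, u, v)" using e by simp_all
    have neg_veronese: "veronese (- u) (- v) = veronese u v" by (simp add: vec_eq_iff forall_3)
    have x: "x \<noteq> 0" using \<phi>[OF guv(1)] guv(2) by (auto simp: primitive_def)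
    have "{e \<in> \<Omega>. \<phi> e = x} = {(g, u, v), (g, - u, - v)}"
    proof (intro equalityI subsetI)
      fix e assume e: "e \<in> {e \<in> \<Omega>. \<phi> e = x}"
      obtain g' u' v' where e': "e = (g', u', v')" by (cases e)
      have "g = g' \<and> ((u', v') = (u, v) \<or> (u', v') = (- u, - v))"
        using \<phi>[OF guv(1)] \<phi>[of g' u' v'] e x guv(2) by (intro chart_fibre[of u v g x]) (auto simp: e')
      then show "e \<in> {(g, u, v), (g, - u, - v)}" by (auto simp: e')
    next
      fix e assume "e \<in> {(g, u, v), (g, - u, - v)}"
      then show "e \<in> {e \<in> \<Omega>. \<phi> e = x}"
        using guv by (auto simp: \<Omega>_def E_def admissible_pairs_def admissible_def lattice_box_def \<phi>_def neg_veronese)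
    qed
    moreover have "(u, v) \<noteq> (- u, - v)" using \<phi>[OF guv(1)] by auto
    ultimately show ?thesis by auto
  qed
  have "weighted_count A w L \<Gamma> B = infsum h Zs"
    by (simp add: weighted_count_def h_def[abs_def] Zs_def)
  also have "\<dots> = infsum h (\<phi> ` \<Omega>)"
    by (rule infsum_cong_neutral) (use sub sup in auto)
  also have "\<dots> = sum h (\<phi> ` \<Omega>)" using fin by simp
  finally have "2 * weighted_count A w L \<Gamma> B = (\<Sum>x\<in>\<phi> ` \<Omega>. \<Sum>e | e \<in> \<Omega> \<and> \<phi> e = x. h (\<phi> e))"
    using card by (simp add: sum_distrib_left)
  also have "\<dots> = (\<Sum>e\<in>\<Omega>. h (\<phi> e))"
    by (rule sum.image_gen[OF fin, symmetric])
  also have "\<dots> = (\<Sum>e\<in>\<Omega>. chart_weight w (fst e) (fst (snd e) / sqrt B, snd (snd e) / sqrt B))"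
  proof (intro sum.cong refl)
    fix e assume e: "e \<in> \<Omega>"
    obtain g u v where [simp]: "e = (g, u, v)" by (cases e)
    show "h (\<phi> e) = chart_weight w (fst e) (fst (snd e) / sqrt B, snd (snd e) / sqrt B)"
      using \<phi>[of g u v] e B chart_weight_lattice_point[of u v g "\<phi> e" B w] by (simp add: h_def)
  qed
  also have "\<dots> = (\<Sum>g\<in>G. \<Sum>z\<in>E g. chart_weight w g (fst z / sqrt B, snd z / sqrt B))"
    unfolding \<Omega>_def using finG by (subst sum.Sigma) (auto simp: E_def case_prod_beta)
  also have "\<dots> = (\<Sum>g\<in>G. planar_weight.scaled_sum (chart_weight w g) (E g) (sqrt B))"
    by (intro sum.cong refl) (simp add: planar_weight.scaled_sum_def[OF w[OF g0]])
  finally show ?thesis by (simp add: G_def E_def)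
qed

text \<open>By periodicity the coprime pairs of a residue class modulo \<open>M\<close> are all
  admissible or none is, so one admissible representative decides. The absolute value keeps
  \<open>M\<close> positive, with residues in \<open>{0..<M}\<close>.\<close>

lemma chart_sum_eq_class_sums:
  fixes \<Gamma> :: "int^3"
  assumes w: "planar_weight (chart_weight w g) R \<Lambda>" and g: "g dvd D" and L: "L > 0"
  defines "M \<equiv> \<bar>D\<bar> * int L"
  defines "c \<equiv> (\<lambda>r. \<exists>u v. coprime u v \<and> admissible L \<Gamma> g u v \<and> (u mod M, v mod M) = r)"
  shows "planar_weight.scaled_sum (chart_weight w g) (admissible_pairs L \<Gamma> g (R * X)) X =
    (\<Sum>r\<in>{0..<M} \<times> {0..<M}. if c r then planar_weight.primitive_class_sum (chart_weight w g) R M r X else 0)"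
proof -
  interpret planar_weight "chart_weight w g" R \<Lambda> by (rule w)
  have M: "M > 0" using D_nonzero L by (simp add: M_def)
  have M_abs: "M = \<bar>D * int L\<bar>" by (simp add: M_def abs_mult)
  define E where "E = admissible_pairs L \<Gamma> g (R * X)"
  define f where "f z = chart_weight w g (real_of_int (fst z) / X, real_of_int (snd z) / X)" for z :: "int \<times> int"
  define res where "res z = (fst z mod M, snd z mod M)" for z
  have classes: "{z \<in> E. res z = r} = (if c r then {z \<in> class_box M r (R * X). coprime (fst z) (snd z)} else {})"
    if r: "r \<in> {0..<M} \<times> {0..<M}" for r
  proof -
    have res_iff: "res z = r \<longleftrightarrow> [fst z = fst r] (mod M) \<and> [snd z = snd r] (mod M)" for z
      using r by (auto simp: res_def cong_def prod_eq_iff)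
    have "z \<in> E" if z: "z \<in> lattice_box (R * X)" "coprime (fst z) (snd z)" "res z = r" and "c r" for z
    proof -
      obtain u v where uv: "coprime u v" "admissible L \<Gamma> g u v" "(u mod M, v mod M) = r"
        using \<open>c r\<close> by (auto simp: c_def)
      have "[fst z = u] (mod M)" "[snd z = v] (mod M)"
        using uv(3) z(3) by (auto simp: res_def cong_def)
      then have "[fst z = u] (mod D * int L)" "[snd z = v] (mod D * int L)"
        unfolding M_abs cong_iff_dvd_diff by simp_all
      then have "admissible L \<Gamma> g (fst z) (snd z)"
        by (rule admissible_periodic[OF g uv(2) z(2)])
      then show ?thesis using z by (simp add: E_def admissible_pairs_def)
    qed
    moreover have "c (res z)" if "z \<in> E" for z
      using that by (auto simp: c_def E_def admissible_pairs_def res_def)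
    ultimately show ?thesis
      by (auto simp: res_iff[symmetric] class_box_def E_def admissible_pairs_def)
  qed
  have "scaled_sum E X = (\<Sum>r\<in>{0..<M} \<times> {0..<M}. \<Sum>z | z \<in> E \<and> res z = r. f z)"
    unfolding scaled_sum_def f_def using M
    by (intro sum.group[symmetric]) (auto simp: E_def res_def)
  also have "\<dots> = (\<Sum>r\<in>{0..<M} \<times> {0..<M}. if c r then primitive_class_sum M r X else 0)"
    by (intro sum.cong refl) (simp add: classes primitive_class_sum_def scaled_sum_def f_def)
  finally show ?thesis by (simp add: E_def)
qed

end

section \<open>Summation over scales and classes, and the final error term\<close>

lemma sum_asymptotics:
  fixes S :: "'a \<Rightarrow> real \<Rightarrow> real"
  assumes "finite I" "\<And>i. i \<in> I \<Longrightarrow> \<exists>K C. \<forall>X>0. \<bar>S i X - K * X\<^sup>2\<bar> \<le> C * X powr (3/2)"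
  shows "\<exists>K C. \<forall>X>0. \<bar>(\<Sum>i\<in>I. S i X) - K * X\<^sup>2\<bar> \<le> C * X powr (3/2)"
proof -
  obtain K C where KC: "\<And>i X. i \<in> I \<Longrightarrow> X > 0 \<Longrightarrow> \<bar>S i X - K i * X\<^sup>2\<bar> \<le> C i * X powr (3/2)"
    using assms(2) by metis
  have "\<bar>(\<Sum>i\<in>I. S i X) - (\<Sum>i\<in>I. K i) * X\<^sup>2\<bar> \<le> (\<Sum>i\<in>I. C i) * X powr (3/2)" if "X > 0" for X
  proof -
    have "\<bar>(\<Sum>i\<in>I. S i X) - (\<Sum>i\<in>I. K i) * X\<^sup>2\<bar> = \<bar>\<Sum>i\<in>I. S i X - K i * X\<^sup>2\<bar>"
      by (simp add: sum_subtractf sum_distrib_right)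
    also have "\<dots> \<le> (\<Sum>i\<in>I. \<bar>S i X - K i * X\<^sup>2\<bar>)" by (rule sum_abs)
    also have "\<dots> \<le> (\<Sum>i\<in>I. C i * X powr (3/2))" using KC that by (intro sum_mono) auto
    finally show ?thesis by (simp add: sum_distrib_right)
  qed
  then show ?thesis by blast
qed

text \<open>The substitution \<open>X = sqrt B\<close> turns \<open>X\<^sup>2\<close> into
  \<open>B\<close> and \<open>X powr (3/2)\<close> into \<open>B powr (3/4)\<close>. Both constants
  are halved because each zero is counted twice.\<close>

lemma (in conic_chart) weighted_count_asymptotics:
  assumes w: "weight_function w" and L: "L > 0"
  shows "\<exists>K C. \<forall>B>0. \<bar>weighted_count A w L \<Gamma> B - K * B\<bar> \<le> C * B powr (3/4)"
proof -
  have "\<forall>g. \<exists>R \<Lambda>. g \<noteq> 0 \<longrightarrow> planar_weight (chart_weight w g) R \<Lambda>"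
    using planar_weight_chart_weight[OF w] by blast
  then obtain R \<Lambda> where R: "\<And>g. g \<noteq> 0 \<Longrightarrow> planar_weight (chart_weight w g) (R g) (\<Lambda> g)" by metis
  define S where "S g X = planar_weight.scaled_sum (chart_weight w g) (admissible_pairs L \<Gamma> g (R g * X)) X" for g X
  have "\<exists>K C. \<forall>X>0. \<bar>S g X - K * X\<^sup>2\<bar> \<le> C * X powr (3/2)" if g: "g \<in> {g. g dvd D}" for g
  proof -
    have "g dvd D" "g \<noteq> 0" using g D_nonzero by auto
    interpret planar_weight "chart_weight w g" "R g" "\<Lambda> g" by (rule R) fact
    have M: "\<bar>D\<bar> * int L > 0" using D_nonzero L by simp
    have classes: "\<exists>K C. \<forall>X>0. \<bar>primitive_class_sum (\<bar>D\<bar> * int L) r X - K * X\<^sup>2\<bar> \<le> C * X powr (3/2)" for r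
      using primitive_class_sum_asymptotics[OF M, of r] by blast
    have zero: "\<exists>K C. \<forall>X>(0::real). \<bar>0 - K * X\<^sup>2\<bar> \<le> C * X powr (3/2)"
      by (intro exI[of _ 0]) simp
    show ?thesis
      unfolding S_def chart_sum_eq_class_sums[OF planar_weight_axioms \<open>g dvd D\<close> L]
    proof (rule sum_asymptotics)
      fix r
      show "\<exists>K C. \<forall>X>0. \<bar>(if \<exists>u v. coprime u v \<and> admissible L \<Gamma> g u v \<and> (u mod (\<bar>D\<bar> * int L), v mod (\<bar>D\<bar> * int L)) = r
           then primitive_class_sum (\<bar>D\<bar> * int L) r X else 0) - K * X\<^sup>2\<bar> \<le> C * X powr (3/2)"
        using classes[of r] zero by (simp only: split: if_split) blast
    qed simp
  qed
  then have "\<exists>K C. \<forall>X>0. \<bar>(\<Sum>g | g dvd D. S g X) - K * X\<^sup>2\<bar> \<le> C * X powr (3/2)"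
    using D_nonzero by (intro sum_asymptotics) auto
  then obtain K C where KC: "\<And>X. X > 0 \<Longrightarrow> \<bar>(\<Sum>g | g dvd D. S g X) - K * X\<^sup>2\<bar> \<le> C * X powr (3/2)" by blast
  have "\<bar>weighted_count A w L \<Gamma> B - K / 2 * B\<bar> \<le> C / 2 * B powr (3/4)" if B: "B > 0" for B
  proof -
    have "sqrt B powr (3/2) = B powr (3/4)"
      using B by (simp add: powr_half_sqrt[symmetric] powr_powr)
    then have "\<bar>2 * weighted_count A w L \<Gamma> B - K * B\<bar> \<le> C * B powr (3/4)"
      using KC[of "sqrt B"] B weighted_count_eq_chart_sum[OF R B, of L \<Gamma>] by (simp add: S_def)
    then show ?thesis by linarith
  qed
  then show ?thesis by blast
qed

theorem theorem1p3:
  "\<exists>c0 > 0. \<forall>(A :: int^3^3) (w :: real^3 \<Rightarrow> real) (L :: nat) (\<Gamma> :: int^3).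
     nondegenerate A \<longrightarrow> indefinite A \<longrightarrow> weight_function w \<longrightarrow>
     L > 0 \<longrightarrow> 8 * disc A dvd int L \<longrightarrow>
     [qform A \<Gamma> = 0] (mod int L) \<longrightarrow>
     (\<forall>p. prime p \<longrightarrow> p dvd L \<longrightarrow> \<not> vec_cong \<Gamma> 0 (int p)) \<longrightarrow>
     (\<exists>(G :: complex) (C :: real). \<forall>B :: real. B \<ge> 2 \<longrightarrow>
        cmod (of_real (weighted_count A w L \<Gamma> B) -
              (1 / 2 * of_real (singular_series A L \<Gamma>) * singular_integral A w + G) * of_real B)
          \<le> C * (B * exp (- c0 * sqrt (ln B))))"
proof (rule exI[of _ 1], intro conjI allI impI)
  fix A :: "int^3^3" and w :: "real^3 \<Rightarrow> real" and L :: nat and \<Gamma> :: "int^3"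
  assume A: "nondegenerate A" and w: "weight_function w" and L: "L > 0"
  have "\<exists>K C. \<forall>B>0. \<bar>weighted_count A w L \<Gamma> B - K * B\<bar> \<le> C * B powr (3/4)"
  proof (cases "\<exists>x :: int^3. x \<noteq> 0 \<and> qform A x = 0")
    case True
    then obtain P Q D m where "conic_chart A P Q D m"
      using isotropic_similar_conic[OF A] by blast
    then show ?thesis using w L by (rule conic_chart.weighted_count_asymptotics)
  next
    case False
    \<comment> \<open>Primitive vectors are nonzero, so an anisotropic form has no zeros to count
      and \<open>K = 0\<close> works.\<close>
    then have "{x. primitive x \<and> qform A x = 0 \<and> vec_cong x \<Gamma> (int L)} = {}"
      by (force simp: primitive_def)
    then have "weighted_count A w L \<Gamma> B = 0" for B
      unfolding weighted_count_def by (simp only: infsum_empty)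
    then show ?thesis by (intro exI[of _ 0]) simp
  qed
  then obtain K C where KC: "\<And>B. B > 0 \<Longrightarrow> \<bar>weighted_count A w L \<Gamma> B - K * B\<bar> \<le> C * B powr (3/4)" by blast
  define G where "G = of_real K - 1 / 2 * of_real (singular_series A L \<Gamma>) * singular_integral A w"
  show "\<exists>(G :: complex) (C :: real). \<forall>B :: real. B \<ge> 2 \<longrightarrow>
        cmod (of_real (weighted_count A w L \<Gamma> B) -
              (1 / 2 * of_real (singular_series A L \<Gamma>) * singular_integral A w + G) * of_real B)
          \<le> C * (B * exp (- 1 * sqrt (ln B)))"
  proof (intro exI[of _ G] exI[of _ "\<bar>C\<bar> * exp 1"] allI impI)
    fix B :: real assume B: "B \<ge> 2"
    have "cmod (of_real (weighted_count A w L \<Gamma> B) -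
              (1 / 2 * of_real (singular_series A L \<Gamma>) * singular_integral A w + G) * of_real B)
        = cmod (of_real (weighted_count A w L \<Gamma> B - K * B))"
      by (simp add: G_def)
    also have "\<dots> = \<bar>weighted_count A w L \<Gamma> B - K * B\<bar>" by (rule norm_of_real)
    also have "\<dots> \<le> C * B powr (3/4)" using KC[of B] B by simp
    also have "\<dots> \<le> \<bar>C\<bar> * B powr (3/4)" by (intro mult_right_mono) auto
    \<comment> \<open>In terms of \<open>s = sqrt (ln B)\<close> the claim is
      \<open>3 / 4 * s\<^sup>2 \<le> 1 + s\<^sup>2 - s\<close>, which is
      \<open>(s / 2 - 1)\<^sup>2 \<ge> 0\<close>. This explains the factor \<open>exp 1\<close> that
      goes with \<open>c0 = 1\<close>.\<close>
    also have "B powr (3/4) \<le> exp 1 * (B * exp (- 1 * sqrt (ln B)))"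
    proof -
      define s where "s = sqrt (ln B)"
      have s: "ln B = s\<^sup>2" using B by (simp add: s_def)
      have "3 / 4 * s\<^sup>2 \<le> 1 + s\<^sup>2 - s"
        using zero_le_power2[of "s / 2 - 1"] by (simp add: power2_eq_square algebra_simps)
      then have "exp (3 / 4 * s\<^sup>2) \<le> exp (1 + s\<^sup>2 - s)" by simp
      also have "\<dots> = exp 1 * (exp (s\<^sup>2) * exp (- 1 * s))"
        by (simp add: exp_add[symmetric] algebra_simps)
      also have "exp (s\<^sup>2) = B" using B by (simp add: s[symmetric])
      finally show ?thesis using B by (simp add: powr_def s[symmetric] s_def[symmetric])
    qed
    finally show "cmod (of_real (weighted_count A w L \<Gamma> B) -
              (1 / 2 * of_real (singular_series A L \<Gamma>) * singular_integral A w + G) * of_real B)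
          \<le> \<bar>C\<bar> * exp 1 * (B * exp (- 1 * sqrt (ln B)))"
      by (simp add: mult.assoc mult_left_mono)
  qed
qed simp

end
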